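(* Let $O\neq I$ be points of a Desargues affine plane, let $B,C\in\ell^{OI}$ be different fixed points, and let $\mathcal{R}_3=\{r_{BC}(X)\mid X\in\ell^{OI}\}$, where $r_{BC}(X)=(B-C)^{-1}\cdot(X-C)$. Then $\mathcal{R}_3$ forms a skew field with the addition and multiplication of points of $\ell^{OI}$, and $(\mathcal{R}_3,+,\cdot)$ is a sub-skew field of the skew field $(\ell^{OI},+,\cdot)$.
   Context: An affine plane consists of a nonempty set of points and a nonempty set of lines (sets of points) such that: any two distinct points $P,Q$ lie on exactly one line $\ell^{PQ}$; for every line $\ell$ and every point $P\notin\ell$ there is exactly one line through $P$ disjoint from $\ell$; and there exist three non-collinear points. Two lines are parallel if they are equal or disjoint. A Desargues affine plane is an affine plane satisfying Desargues' axiom: if $A,B,C,A',B',C'$ are points such that $\ell^{AA'},\ell^{BB'},\ell^{CC'},\ell^{AC},\ell^{A'C'}$ are pairwise distinct lines, $\ell^{AA'},\ell^{BB'},\ell^{CC'}$ are either all parallel or all pass through one common point, $\ell^{AB}\neq\ell^{A'B'}$, $\ell^{BC}\neq\ell^{B'C'}$, $\ell^{AB}\parallel\ell^{A'B'}$ and $\ell^{BC}\parallel\ell^{B'C'}$, then $\ell^{AC}\parallel\ell^{A'C'}$. Fix distinct points $O,I$. For $A,B\in\ell^{OI}$ choose an auxiliary point $B_1\notin\ell^{OI}$. Addition: let $P_1$ be the intersection of the line through $B_1$ parallel to $\ell^{OI}$ with the line through $A$ parallel to $\ell^{OB_1}$; then $A+B$ is the intersection of $\ell^{OI}$ with the line through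 $P_1$ parallel to $\ell^{BB_1}$. Multiplication: let $P_1$ be the intersection of the line through $A$ parallel to $\ell^{IB_1}$ with $\ell^{OB_1}$; then $A\cdot B$ is the intersection of $\ell^{OI}$ with the line through $P_1$ parallel to $\ell^{BB_1}$. It is known that these operations do not depend on $B_1$ and that $(\ell^{OI},+,\cdot)$ is a skew field (division ring) with zero $O$ and identity $I$; inverses and differences are taken in this skew field. For $X,B,C\in\ell^{OI}$ with $B\neq C$, the ratio of the three points is the point $r_{BC}(X)=r(X,B;C)=(B-C)^{-1}\cdot(X-C)\in\ell^{OI}$. *)

theory Defs
  imports "HOL-Algebra.Subrings"
begin

definition parallel :: "'p set \<Rightarrow> 'p set \<Rightarrow> bool"  (infix "\<parallel>" 50)
  where "l \<parallel> m \<longleftrightarrow> l = m \<or> l \<inter> m = {}"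

locale affine_plane =
  fixes \<P> :: "'p set" and \<L> :: "'p set set"
  assumes points_nonempty: "\<P> \<noteq> {}"
    and lines_nonempty: "\<L> \<noteq> {}"
    and lines_subset: "l \<in> \<L> \<Longrightarrow> l \<subseteq> \<P>"
    and unique_line: "\<lbrakk>P \<in> \<P>; Q \<in> \<P>; P \<noteq> Q\<rbrakk> \<Longrightarrow> \<exists>!l. l \<in> \<L> \<and> P \<in> l \<and> Q \<in> l"
    and unique_disjoint:
      "\<lbrakk>l \<in> \<L>; P \<in> \<P>; P \<notin> l\<rbrakk> \<Longrightarrow> \<exists>!m. m \<in> \<L> \<and> P \<in> m \<and> m \<inter> l = {}"
    and noncollinear:
      "\<exists>P\<in>\<P>. \<exists>Q\<in>\<P>. \<exists>R\<in>\<P>. P \<noteq> Q \<and> Q \<noteq> R \<and> P \<noteq> R \<and>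
         \<not> (\<exists>l\<in>\<L>. P \<in> l \<and> Q \<in> l \<and> R \<in> l)"

text \<open>The next three descriptions are meaningful only where the object is unique: for distinct
  points, for any point and line, and for two distinct non-parallel lines, respectively.\<close>

definition line_through :: "'p set set \<Rightarrow> 'p \<Rightarrow> 'p \<Rightarrow> 'p set"
  where "line_through \<L> P Q = (THE l. l \<in> \<L> \<and> P \<in> l \<and> Q \<in> l)"

definition parallel_through :: "'p set set \<Rightarrow> 'p \<Rightarrow> 'p set \<Rightarrow> 'p set"
  where "parallel_through \<L> P l = (THE m. m \<in> \<L> \<and> P \<in> m \<and> m \<parallel> l)"

definition meet_point :: "'p set \<Rightarrow> 'p set \<Rightarrow> 'p"
  where "meet_point l m = (THE P. P \<in> l \<and> P \<in> m)"

text \<open>The nine disequations of points in Desargues' axiom are what it takes for the lines it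
  mentions to be defined.\<close>

locale desargues_affine_plane = affine_plane +
  assumes desargues:
    "\<lbrakk>A \<in> \<P>; B \<in> \<P>; C \<in> \<P>; A' \<in> \<P>; B' \<in> \<P>; C' \<in> \<P>;
      A \<noteq> A'; B \<noteq> B'; C \<noteq> C'; A \<noteq> B; B \<noteq> C; A \<noteq> C; A' \<noteq> B'; B' \<noteq> C'; A' \<noteq> C';
      distinct [line_through \<L> A A', line_through \<L> B B', line_through \<L> C C',
                line_through \<L> A C, line_through \<L> A' C'];
      (line_through \<L> A A' \<parallel> line_through \<L> B B' \<and>
       line_through \<L> B B' \<parallel> line_through \<L> C C' \<and>
       line_through \<L> A A' \<parallel> line_through \<L> C C') \<or>
      (\<exists>V. V \<in> line_through \<L> A A' \<and> V \<in> line_through \<L> B B' \<and> V \<in> line_through \<L> C C');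
      line_through \<L> A B \<noteq> line_through \<L> A' B';
      line_through \<L> B C \<noteq> line_through \<L> B' C';
      line_through \<L> A B \<parallel> line_through \<L> A' B';
      line_through \<L> B C \<parallel> line_through \<L> B' C'\<rbrakk>
     \<Longrightarrow> line_through \<L> A C \<parallel> line_through \<L> A' C'"

definition add_via :: "'p set set \<Rightarrow> 'p \<Rightarrow> 'p \<Rightarrow> 'p \<Rightarrow> 'p \<Rightarrow> 'p \<Rightarrow> 'p"
  where "add_via \<L> O\<^sub>0 I B\<^sub>1 A B =
    (let P\<^sub>1 = meet_point (parallel_through \<L> B\<^sub>1 (line_through \<L> O\<^sub>0 I))
                        (parallel_through \<L> A (line_through \<L> O\<^sub>0 B\<^sub>1))
     in meet_point (line_through \<L> O\<^sub>0 I) (parallel_through \<L> P\<^sub>1 (line_through \<L> B B\<^sub>1)))"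

definition mult_via :: "'p set set \<Rightarrow> 'p \<Rightarrow> 'p \<Rightarrow> 'p \<Rightarrow> 'p \<Rightarrow> 'p \<Rightarrow> 'p"
  where "mult_via \<L> O\<^sub>0 I B\<^sub>1 A B =
    (let P\<^sub>1 = meet_point (parallel_through \<L> A (line_through \<L> I B\<^sub>1)) (line_through \<L> O\<^sub>0 B\<^sub>1)
     in meet_point (line_through \<L> O\<^sub>0 I) (parallel_through \<L> P\<^sub>1 (line_through \<L> B B\<^sub>1)))"

definition aux_point :: "'p set \<Rightarrow> 'p set \<Rightarrow> 'p"
  where "aux_point \<P> l = (SOME B\<^sub>1. B\<^sub>1 \<in> \<P> \<and> B\<^sub>1 \<notin> l)"

text \<open>Sum and product do not depend on the auxiliary point off the line in a Desargues affine plane,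
  so an unspecified one is used.\<close>

definition line_ring :: "'p set \<Rightarrow> 'p set set \<Rightarrow> 'p \<Rightarrow> 'p \<Rightarrow> 'p ring"
  where "line_ring \<P> \<L> O\<^sub>0 I =
    \<lparr>carrier = line_through \<L> O\<^sub>0 I,
     mult = mult_via \<L> O\<^sub>0 I (aux_point \<P> (line_through \<L> O\<^sub>0 I)),
     one = I,
     zero = O\<^sub>0,
     add = add_via \<L> O\<^sub>0 I (aux_point \<P> (line_through \<L> O\<^sub>0 I))\<rparr>"

locale skew_field = ring +
  assumes one_not_zero: "\<one> \<noteq> \<zero>"
    and skew_field_Units: "Units R = carrier R - {\<zero>}"

locale sub_skew_field = skew_field R + subring K R for K and R (structure) +
  assumes skew_field_restrict: "skew_field (R\<lparr>carrier := K\<rparr>)"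

definition ratio3 :: "('p, 'm) ring_scheme \<Rightarrow> 'p \<Rightarrow> 'p \<Rightarrow> 'p \<Rightarrow> 'p"
  where "ratio3 K B C X = inv\<^bsub>K\<^esub> (B \<ominus>\<^bsub>K\<^esub> C) \<otimes>\<^bsub>K\<^esub> (X \<ominus>\<^bsub>K\<^esub> C)"

definition ratio_set :: "('p, 'm) ring_scheme \<Rightarrow> 'p \<Rightarrow> 'p \<Rightarrow> 'p set"
  where "ratio_set K B C = {ratio3 K B C X | X. X \<in> carrier K}"

end

theory Submission
  imports Defs
begin

text \<open>Desargues' axiom provides a translation taking any point to any other and a dilatation with centre
  \<open>O\<close> taking \<open>I\<close> to any point of \<open>OI\<close>. Translations commute, so they make the whole plane an abelian
  group with origin \<open>O\<close>. On \<open>OI\<close>, the sum \<open>A + B\<close> is the image of \<open>B\<close> under the translation taking \<open>O\<close> to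
  \<open>A\<close>, and the product \<open>A \<cdot> B\<close> is its image under the dilatation taking \<open>I\<close> to \<open>A\<close>. Dilatations fixing \<open>O\<close>
  are additive, and they are closed under composition and pointwise addition; as such a dilatation is
  determined by the image of \<open>I\<close>, the laws of a skew field follow. Finally, \<open>X = (B - C) \<cdot> Y + C\<close> has ratio
  \<open>Y\<close>, so the set of ratios is the whole line.\<close>

section \<open>Parallelism of pairs of points\<close>

context affine_plane
begin

text \<open>A degenerate pair of points is parallel to every pair, and collinearity of \<open>A\<close>, \<open>B\<close>, \<open>C\<close> reads
  \<open>par A B A C\<close>. Transitivity therefore needs a nondegenerate pair in the middle.\<close>

definition par :: "'p \<Rightarrow> 'p \<Rightarrow> 'p \<Rightarrow> 'p \<Rightarrow> bool"
  where "par A B C D \<longleftrightarrow> (\<exists>l\<in>\<L>. \<exists>m\<in>\<L>. l \<parallel> m \<and> A \<in> l \<and> B \<in> l \<and> C \<in> m \<and> D \<in> m)"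

lemma ex_line:
  assumes "A \<in> \<P>" "B \<in> \<P>"
  shows "\<exists>l\<in>\<L>. A \<in> l \<and> B \<in> l"
proof -
  obtain C where "C \<in> \<P>" "C \<noteq> A" using noncollinear by metis
  then show ?thesis using assms unique_line by metis
qed

lemma line_eqI: "\<lbrakk>l \<in> \<L>; m \<in> \<L>; A \<in> l; B \<in> l; A \<in> m; B \<in> m; A \<noteq> B\<rbrakk> \<Longrightarrow> l = m"
  using unique_line lines_subset by blast

lemma parallel_eqI: "\<lbrakk>l \<parallel> m; A \<in> l; A \<in> m\<rbrakk> \<Longrightarrow> l = m"
  unfolding parallel_def by blast

lemma parallel_sym: "l \<parallel> m \<Longrightarrow> m \<parallel> l"
  unfolding parallel_def by blast

lemma parallel_refl: "l \<parallel> l"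
  unfolding parallel_def by blast

text \<open>A common point of distinct \<open>l\<close> and \<open>n\<close> would lie off
  \<open>m\<close> and carry two lines disjoint from \<open>m\<close>.\<close>

lemma parallel_trans:
  assumes "l \<in> \<L>" "m \<in> \<L>" "n \<in> \<L>" "l \<parallel> m" "m \<parallel> n"
  shows "l \<parallel> n"
proof (rule ccontr)
  assume "\<not> l \<parallel> n"
  then obtain P where P: "P \<in> l" "P \<in> n" "l \<noteq> n" unfolding parallel_def by blast
  moreover have "P \<notin> m" using P assms(4,5) parallel_eqI by metis
  moreover have "P \<in> \<P>" using P assms(1) lines_subset by blast
  ultimately show False
    using unique_disjoint[OF assms(2)] assms unfolding parallel_def by blast
qed

lemma ex_parallel:
  assumes "l \<in> \<L>" "P \<in> \<P>"
  shows "\<exists>m\<in>\<L>. P \<in> m \<and> m \<parallel> l"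
  using unique_disjoint[OF assms] assms unfolding parallel_def by blast

lemma parallel_through_eq:
  assumes "l \<in> \<L>" "m \<in> \<L>" "P \<in> m" "m \<parallel> l"
  shows "parallel_through \<L> P l = m"
  unfolding parallel_through_def
  by (rule the_equality) (use assms parallel_eqI parallel_trans parallel_sym in metis)+

lemma line_through_eq:
  assumes "l \<in> \<L>" "A \<in> l" "B \<in> l" "A \<noteq> B"
  shows "line_through \<L> A B = l"
  unfolding line_through_def
  by (rule the_equality) (use assms line_eqI in metis)+

lemma line_through:
  assumes "A \<in> \<P>" "B \<in> \<P>" "A \<noteq> B"
  shows "line_through \<L> A B \<in> \<L>" "A \<in> line_through \<L> A B" "B \<in> line_through \<L> A B"
  using ex_line[OF assms(1,2)] line_through_eq assms(3) by metis+

lemma meet_point_eq: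
  assumes "l \<in> \<L>" "m \<in> \<L>" "\<not> l \<parallel> m" "P \<in> l" "P \<in> m"
  shows "meet_point l m = P"
  unfolding meet_point_def
  by (rule the_equality) (use assms line_eqI parallel_refl in metis)+

lemma par_points: "par A B C D \<Longrightarrow> A \<in> \<P> \<and> B \<in> \<P> \<and> C \<in> \<P> \<and> D \<in> \<P>"
  unfolding par_def using lines_subset by blast

lemma par_sym: "par A B C D \<Longrightarrow> par C D A B"
  unfolding par_def using parallel_sym by blast

lemma par_swap: "par A B C D \<Longrightarrow> par B A C D"
  unfolding par_def by blast

lemma par_refl: "\<lbrakk>A \<in> \<P>; B \<in> \<P>\<rbrakk> \<Longrightarrow> par A B A B"
  unfolding par_def using ex_line parallel_refl by metis

lemma par_triv: "\<lbrakk>A \<in> \<P>; C \<in> \<P>; D \<in> \<P>\<rbrakk> \<Longrightarrow> par A A C D"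
  unfolding par_def using ex_line ex_parallel by metis

lemma par_triv': "\<lbrakk>A \<in> \<P>; C \<in> \<P>; D \<in> \<P>\<rbrakk> \<Longrightarrow> par C D A A"
  using par_triv par_sym by blast

lemma par_trans:
  assumes "par A B C D" "par C D E F" "C \<noteq> D"
  shows "par A B E F"
proof -
  obtain l m where 1: "l \<in> \<L>" "m \<in> \<L>" "l \<parallel> m" "A \<in> l" "B \<in> l" "C \<in> m" "D \<in> m"
    using assms(1) unfolding par_def by blast
  obtain n k where 2: "n \<in> \<L>" "k \<in> \<L>" "n \<parallel> k" "C \<in> n" "D \<in> n" "E \<in> k" "F \<in> k"
    using assms(2) unfolding par_def by blast
  have "m = n" using line_eqI 1 2 assms(3) by metis
  then have "l \<parallel> k" using parallel_trans 1 2 by metis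
  then show ?thesis unfolding par_def using 1 2 by blast
qed

text \<open>Parallel lines sharing \<open>A\<close> coincide, so all three points lie on one
  line.\<close>

lemma par_col:
  assumes "par A B A C"
  shows "par A B B C"
  using assms unfolding par_def by (metis parallel_eqI)

text \<open>With the next lemma, the bridge between \<open>par\<close> and the lines in Desargues'
  axiom and in the two operations.\<close>

lemma par_line_through:
  assumes "A \<in> \<P>" "B \<in> \<P>" "A \<noteq> B" "C \<in> \<P>" "D \<in> \<P>" "C \<noteq> D"
  shows "line_through \<L> A B \<parallel> line_through \<L> C D \<longleftrightarrow> par A B C D"
  unfolding par_def using assms line_through line_through_eq by metis

lemma in_line_through_iff:
  assumes "A \<in> \<P>" "B \<in> \<P>" "A \<noteq> B"
  shows "C \<in> line_through \<L> A B \<longleftrightarrow> par A B A C"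
  unfolding par_def
  using assms line_through line_through_eq[of _ A B] parallel_eqI parallel_refl by metis

lemma par_meet:
  assumes "\<not> par A B C D" "A \<in> \<P>" "B \<in> \<P>" "C \<in> \<P>" "D \<in> \<P>" "P \<in> \<P>" "Q \<in> \<P>"
  shows "\<exists>X. par A B P X \<and> par C D Q X"
proof -
  have ne: "A \<noteq> B" "C \<noteq> D" using assms par_triv par_triv' by auto
  let ?l = "line_through \<L> A B" and ?m = "line_through \<L> C D"
  have lm: "?l \<in> \<L>" "?m \<in> \<L>" "\<not> ?l \<parallel> ?m" using ne assms line_through par_line_through by auto
  obtain l' where l': "l' \<in> \<L>" "P \<in> l'" "l' \<parallel> ?l" using ex_parallel lm assms by metis
  obtain m' where m': "m' \<in> \<L>" "Q \<in> m'" "m' \<parallel> ?m" using ex_parallel lm assms by metis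
  have "\<not> l' \<parallel> m'" using parallel_trans parallel_sym l' m' lm by metis
  then obtain X where "X \<in> l'" "X \<in> m'" unfolding parallel_def by blast
  then have "par A B P X" "par C D Q X"
    unfolding par_def
    using l' m' lm(1,2) line_through[OF assms(2,3) ne(1)] line_through[OF assms(4,5) ne(2)] parallel_sym
    by blast+
  then show ?thesis by blast
qed

text \<open>Two distinct solutions would span a line parallel to both \<open>A B\<close> and
  \<open>C D\<close>. This is the usual way below to prove two points equal.\<close>

lemma par_unique:
  assumes "par A B P X" "par A B P Y" "par C D Q X" "par C D Q Y" "\<not> par A B C D"
  shows "X = Y"
proof (rule ccontr)
  assume "X \<noteq> Y"
  have ne: "A \<noteq> B" "C \<noteq> D" using assms par_points par_triv par_triv' by metis+
  have "par P X P Y" "par Q X Q Y" using assms(1-4) ne par_sym par_trans by metis+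
  then have "par X Y P X" "par X Y Q X" using par_col par_sym by metis+
  then have "par X Y A B" "par X Y C D"
    using \<open>X \<noteq> Y\<close> assms(1-4) ne par_sym par_swap par_trans par_col by (metis)+
  then show False using assms(5) \<open>X \<noteq> Y\<close> par_trans par_sym by metis
qed

lemma ex_off:
  assumes "A \<in> \<P>" "B \<in> \<P>" "A \<noteq> B"
  shows "\<exists>C\<in>\<P>. \<not> par A B A C"
  using noncollinear line_through[OF assms] in_line_through_iff[OF assms] by metis

text \<open>For \<open>A \<noteq> B\<close>, \<open>par A B C D\<close> places \<open>C\<close> and
  \<open>D\<close> on one line in the direction of \<open>A B\<close>; two such lines through
  \<open>D\<close> coincide.\<close>

lemma line_ext:
  assumes "par A B C D" "par A B D E" "A \<noteq> B"
  shows "par A B C E"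
proof (cases "C = D")
  case False
  have "par D C D E" using assms par_sym par_swap par_trans by metis
  then have "par C D C E" using par_col par_swap by metis
  then show ?thesis using assms False par_trans by metis
qed (use assms in auto)

lemma on_line:
  assumes "A \<noteq> B" "par A B A W" "par A B A X" "par A B A Y" "par A B A Z"
  shows "par W X Y Z"
proof -
  have "par A B W A" "par A B Y A" using assms par_sym par_swap by metis+
  then have "par A B W X" "par A B Y Z" using assms line_ext by metis+
  then show ?thesis using assms(1) par_sym par_trans by metis
qed

lemma par_flips: "par A B C D \<longleftrightarrow> par C D A B" "par A B C D \<longleftrightarrow> par B A C D" "par A B C D \<longleftrightarrow> par A B D C"
  using par_sym par_swap by metis+

lemma col_perm: "par A B A C \<longleftrightarrow> par B A B C" "par A B A C \<longleftrightarrow> par A C A B"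
  using par_sym par_swap par_col by metis+

lemma not_par_ne:
  assumes "\<not> par A B C D" "A \<in> \<P>" "B \<in> \<P>" "C \<in> \<P>" "D \<in> \<P>"
  shows "A \<noteq> B" "C \<noteq> D"
  using assms par_triv par_triv' by auto

text \<open>The parallel to \<open>Q R\<close> through \<open>V\<close> is a third line of the
  pencil at \<open>V\<close>. As \<open>S\<close> completes a parallelogram, even the plane of four
  points has one.\<close>

lemma ex_third:
  assumes "\<not> par V Q V R" "V \<in> \<P>" "Q \<in> \<P>" "R \<in> \<P>"
  shows "\<exists>S\<in>\<P>. \<not> par V Q V S \<and> \<not> par V R V S"
proof -
  have "\<not> par Q R V Q" using assms col_perm par_flips by metis
  then obtain S where S: "par Q R V S" "par V Q R S" using assms par_meet by metis
  have "S \<in> \<P>" using S par_points by metis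
  moreover have "V \<noteq> S" using S(2) assms(1) par_flips by metis
  moreover have "\<not> par V Q V S" using S(1) \<open>V \<noteq> S\<close> \<open>\<not> par Q R V Q\<close> par_trans par_sym by metis
  moreover have "\<not> par V R V S"
    using S(1) \<open>V \<noteq> S\<close> assms(1) par_trans par_flips col_perm by metis
  ultimately show ?thesis by blast
qed

text \<open>Constant maps count as dilatations; this gives the zero of the skew field a dilatation.\<close>

definition dilatation :: "('p \<Rightarrow> 'p) \<Rightarrow> bool"
  where "dilatation \<sigma> \<longleftrightarrow> (\<forall>X\<in>\<P>. \<forall>Y\<in>\<P>. par X Y (\<sigma> X) (\<sigma> Y))"

text \<open>Asking for parallel traces, not for absence of fixed points, keeps the identity and
  rules out the constant maps.\<close>

definition translation :: "('p \<Rightarrow> 'p) \<Rightarrow> bool"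
  where "translation \<tau> \<longleftrightarrow> dilatation \<tau> \<and> (\<forall>X\<in>\<P>. \<forall>Y\<in>\<P>. par X (\<tau> X) Y (\<tau> Y))"

end

section \<open>Consequences of Desargues' axiom\<close>

context desargues_affine_plane
begin

text \<open>Placing each pair of points on its own line of the pencil settles the conditions of the
  axiom that compare spanned lines.\<close>

lemma desargues_lines:
  assumes lines: "a \<in> \<L>" "b \<in> \<L>" "c \<in> \<L>"
    and A: "A \<in> a" "A' \<in> a" "A \<notin> b" "A' \<notin> b" "A \<notin> c" "A' \<notin> c"
    and B: "B \<in> b" "B' \<in> b" "B \<notin> a" "B' \<notin> a" "B \<notin> c" "B' \<notin> c"
    and C: "C \<in> c" "C' \<in> c" "C \<notin> a" "C' \<notin> a" "C \<notin> b" "C' \<notin> b"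
    and ne: "A \<noteq> A'" "B \<noteq> B'" "C \<noteq> C'"
    and pencil: "a \<parallel> b \<and> b \<parallel> c \<and> a \<parallel> c \<or> (\<exists>V. V \<in> a \<and> V \<in> b \<and> V \<in> c)"
    and par: "par A B A' B'" "par B C B' C'"
  shows "par A C A' C'"
proof -
  have pts: "A \<in> \<P>" "B \<in> \<P>" "C \<in> \<P>" "A' \<in> \<P>" "B' \<in> \<P>" "C' \<in> \<P>"
    using par par_points by metis+
  have ne': "A \<noteq> B" "B \<noteq> C" "A \<noteq> C" "A' \<noteq> B'" "B' \<noteq> C'" "A' \<noteq> C'" using A B C by auto
  have abc: "line_through \<L> A A' = a" "line_through \<L> B B' = b" "line_through \<L> C C' = c"
    using line_through_eq lines A B C ne by metis+
  note lt = line_through[OF pts(1,2)] line_through[OF pts(1,3)] line_through[OF pts(2,3)]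
     line_through[OF pts(4,5)] line_through[OF pts(4,6)] line_through[OF pts(5,6)]
  \<comment> \<open>If \<open>A\<close>, \<open>C\<close> and \<open>A'\<close>, \<open>C'\<close>
    spanned the same line, it would contain \<open>A\<close> and \<open>A'\<close>, hence be
    \<open>a\<close>, and \<open>C\<close> is off \<open>a\<close>.\<close>
  have "distinct [a, b, c, line_through \<L> A C, line_through \<L> A' C']"
    using A B C lt ne' line_eqI[OF lines(1) lt(4)] ne
    by (simp, metis)
  moreover have "line_through \<L> A B \<noteq> line_through \<L> A' B'"
    using A B lt ne' line_eqI[OF lines(1) lt(1)] ne by metis
  moreover have "line_through \<L> B C \<noteq> line_through \<L> B' C'"
    using B C lt ne' line_eqI[OF lines(2) lt(7)] ne by metis
  ultimately have "line_through \<L> A C \<parallel> line_through \<L> A' C'"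
    using desargues[OF pts ne(1,2,3) ne', unfolded abc] pencil par par_line_through pts ne' by metis
  then show ?thesis using par_line_through pts ne' by metis
qed

lemma desargues_parallel:
  assumes "A \<noteq> A'" "\<not> par A A' A B" "\<not> par A A' A C" "\<not> par A A' B C"
    and "par A A' B B'" "par A A' C C'" "par A B A' B'" "par B C B' C'"
  shows "par A C A' C'"
proof -
  have pts: "A \<in> \<P>" "B \<in> \<P>" "C \<in> \<P>" "A' \<in> \<P>" "B' \<in> \<P>" "C' \<in> \<P>"
    using assms par_points by metis+
  \<comment> \<open>A fixed \<open>B\<close> would lie on \<open>A A'\<close>, and a fixed
    \<open>C\<close> would give \<open>B C\<close> the direction of \<open>A A'\<close>.\<close>
  have ne: "B \<noteq> B'" "C \<noteq> C'"
    using assms par_col par_sym par_swap par_trans pts par_triv' by metis+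
  let ?a = "line_through \<L> A A'" and ?b = "line_through \<L> B B'" and ?c = "line_through \<L> C C'"
  have par: "?a \<parallel> ?b" "?a \<parallel> ?c" "?b \<parallel> ?c"
    using par_line_through pts ne assms par_trans par_sym by metis+
  note lt = line_through[OF pts(1,4) assms(1)] line_through[OF pts(2,5) ne(1)]
     line_through[OF pts(3,6) ne(2)]
  have "?a \<noteq> ?b" "?a \<noteq> ?c" "?b \<noteq> ?c"
    using assms lt in_line_through_iff[OF pts(1,4) assms(1)] in_line_through_iff[OF pts(2,5) ne(1)]
      par_trans ne by metis+
  then have disj: "?a \<inter> ?b = {}" "?a \<inter> ?c = {}" "?b \<inter> ?c = {}"
    using par unfolding parallel_def by auto
  show ?thesis
    by (rule desargues_lines[of ?a ?b ?c A A' B B' C C']) (use lt disj assms ne par in auto)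
qed

lemma desargues_center:
  assumes off: "\<not> par V A V B" "\<not> par V B V C" "\<not> par V A V C"
    and on: "par V A V A'" "par V B V B'" "par V C V C'"
    and par: "par A B A' B'" "par B C B' C'"
  shows "par A C A' C'"
proof -
  have pts: "V \<in> \<P>" "A \<in> \<P>" "B \<in> \<P>" "C \<in> \<P>" "A' \<in> \<P>" "B' \<in> \<P>" "C' \<in> \<P>"
    using assms par_points by metis+
  have ne: "V \<noteq> A" "V \<noteq> B" "V \<noteq> C" using off pts par_triv par_triv' by metis+
  have off': "\<not> par A B V B" "\<not> par B C V C" "\<not> par B A V A" "\<not> par C B V B"
    using off par_col par_sym par_swap by metis+
  \<comment> \<open>Each image determines its neighbour: \<open>B'\<close> is the meet of
    \<open>V B\<close> with the parallel to \<open>A B\<close> through \<open>A'\<close>. Hence one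
    image at \<open>V\<close> forces the others there, and likewise for fixed points.\<close>
  have V: "A' = V \<longleftrightarrow> B' = V" "B' = V \<longleftrightarrow> C' = V"
    using par_unique[of A B V B' V V B V] par_unique[of B C V C' V V C V]
     par_unique[of B A V A' V V A V] par_unique[of C B V B' V V B V]
     off' on par par_triv' par_sym par_swap pts by metis+
  have F: "A' = A \<longleftrightarrow> B' = B" "B' = B \<longleftrightarrow> C' = C"
    using par_unique[of A B A B' B V B V] par_unique[of B C B C' C V C V]
     par_unique[of B A B A' A V A V] par_unique[of C B C B' B V B V]
     off' on par par_refl par_sym par_swap pts by metis+
  consider "A' = V" | "A' = A" | "A' \<noteq> V" "A' \<noteq> A" by blast
  then show ?thesis
  proof cases
    case 1
    then show ?thesis using V par_triv' pts by metis
  next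
    case 2
    then show ?thesis using F par_refl pts by metis
  next
    case 3
    let ?a = "line_through \<L> V A" and ?b = "line_through \<L> V B" and ?c = "line_through \<L> V C"
    note lt = line_through[OF pts(1,2) ne(1)] line_through[OF pts(1,3) ne(2)]
       line_through[OF pts(1,4) ne(3)]
    note iff = in_line_through_iff[OF pts(1,2) ne(1)] in_line_through_iff[OF pts(1,3) ne(2)]
       in_line_through_iff[OF pts(1,4) ne(3)]
    have mem: "A' \<in> ?a" "B' \<in> ?b" "C' \<in> ?c" using iff on by metis+
    have "B \<notin> ?a" "C \<notin> ?a" "C \<notin> ?b" using iff off by metis+
    then have ab: "X \<in> ?a \<Longrightarrow> X \<in> ?b \<Longrightarrow> X = V" and ac: "X \<in> ?a \<Longrightarrow> X \<in> ?c \<Longrightarrow> X = V"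
       and bc: "X \<in> ?b \<Longrightarrow> X \<in> ?c \<Longrightarrow> X = V" for X
      using lt line_eqI by metis+
    have "B' \<noteq> V" "C' \<noteq> V" "A \<noteq> A'" "B \<noteq> B'" "C \<noteq> C'" using 3 V F by auto
    moreover from this have "A \<notin> ?b" "A' \<notin> ?b" "A \<notin> ?c" "A' \<notin> ?c" "B \<notin> ?a" "B' \<notin> ?a" "B \<notin> ?c" "B' \<notin> ?c"
      "C \<notin> ?a" "C' \<notin> ?a" "C \<notin> ?b" "C' \<notin> ?b"
      using ab ac bc lt mem ne 3 by metis+
    ultimately show ?thesis
      using desargues_lines[of ?a ?b ?c A A' B B' C C'] lt mem par by blast
  qed
qed

section \<open>Dilatations with a given centre\<close>

lemma central_construct:
  assumes "\<not> par V Q V R" "par V Q V Q'" "par V R V R'" "par Q R Q' R'"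
    and "X \<in> \<P>" "\<not> par V Q V X"
  shows "\<exists>X'. par V X V X' \<and> par Q X Q' X' \<and> par R X R' X'"
proof -
  have pts: "V \<in> \<P>" "Q \<in> \<P>" "Q' \<in> \<P>" "R \<in> \<P>" "R' \<in> \<P>" using assms par_points by metis+
  have ne: "V \<noteq> R" "V \<noteq> X" using assms not_par_ne pts by metis+
  have "\<not> par V X Q X" using assms col_perm par_flips by metis
  then obtain X' where X': "par V X V X'" "par Q X Q' X'" using par_meet pts assms by metis
  \<comment> \<open>\<open>X'\<close> was drawn from \<open>Q\<close>; Desargues for the triangle
    \<open>R Q X\<close> shows that it also fits \<open>R\<close>. For \<open>X\<close> on
    \<open>V R\<close> the points \<open>R\<close>, \<open>X\<close>, \<open>R'\<close>,
    \<open>X'\<close> are collinear.\<close>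
  have "par R X R' X'"
  proof (cases "par V R V X")
    case True
    then have "par V R V X'" using X' ne par_trans by metis
    then show ?thesis using on_line[of V R] ne True assms(3) par_refl pts by metis
  next
    case False
    show ?thesis
      by (rule desargues_center[of V R Q X R' Q' X'])
        (use False X' assms col_perm par_flips in metis)+
  qed
  then show ?thesis using X' by blast
qed

text \<open>The image of \<open>X\<close> is constructed from one of two reference points \<open>Q\<close>, \<open>R\<close> not collinear with \<open>V\<close>,
  since neither alone reaches all points. If \<open>X\<close> and \<open>Y\<close> lie one on each of the lines \<open>VQ\<close>, \<open>VR\<close>, no
  reference point is off both \<open>VX\<close> and \<open>VY\<close>, and a point on a third line through \<open>V\<close> takes over.\<close>

lemma ex_central_dilatation:
  assumes "V \<noteq> Q" "par V Q V Q'"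
  shows "\<exists>\<sigma>. dilatation \<sigma> \<and> \<sigma> V = V \<and> \<sigma> Q = Q'"
proof -
  have pts: "V \<in> \<P>" "Q \<in> \<P>" "Q' \<in> \<P>" using assms par_points by metis+
  obtain R where R: "R \<in> \<P>" "\<not> par V Q V R" using ex_off pts assms by metis
  have ne: "V \<noteq> R" "Q \<noteq> R" using R pts par_triv' par_refl by metis+
  have "\<not> par V R Q R" using R col_perm par_flips by metis
  then obtain R' where R': "par V R V R'" "par Q R Q' R'" using par_meet pts R(1) by metis
  \<comment> \<open>\<open>good X X'\<close> lists what an image must satisfy relative to
    \<open>V\<close>, \<open>Q\<close> and \<open>R\<close>. Any two such pairs turn out to be
    parallel, so every choice of images is a dilatation.\<close>
  define good where "good X X' \<longleftrightarrow> (X = V \<longrightarrow> X' = V) \<and> (X = Q \<longrightarrow> X' = Q') \<and>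
    par V X V X' \<and> par Q X Q' X' \<and> par R X R' X'" for X X'
  have ex: "\<exists>X'. good X X'" if X: "X \<in> \<P>" for X
  proof -
    consider "X = V" | "X = Q" | "X \<noteq> Q" "\<not> par V Q V X" "X \<noteq> V" | "X \<noteq> Q" "\<not> par V R V X" "X \<noteq> V"
      using R ne(1) col_perm par_trans X pts by metis
    then show ?thesis
    proof cases
      case 1
      then have "good X V" unfolding good_def using assms R' par_flips par_triv pts by metis
      then show ?thesis by blast
    next
      case 2
      then have "good X Q'" unfolding good_def using assms R' par_flips par_triv pts by metis
      then show ?thesis by blast
    next
      case 3
      then show ?thesis unfolding good_def
        using central_construct[OF R(2) assms(2) R' X] by metis
    next
      case 4
      have "\<not> par V R V Q" "par R Q R' Q'" using R R' par_flips by metis+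
      from central_construct[OF this(1) R'(1) assms(2) this(2) X 4(2)] 4
      show ?thesis unfolding good_def by metis
    qed
  qed
  \<comment> \<open>Desargues for \<open>X\<close>, \<open>Y\<close> and a reference point whose
    line through \<open>V\<close> contains neither.\<close>
  have via: "par X Y X' Y'"
    if "good X X'" "good Y Y'" "X \<in> \<P>" "Y \<in> \<P>" "\<not> par V X V Y"
     "\<not> par V Q V X \<and> \<not> par V Q V Y \<or> \<not> par V R V X \<and> \<not> par V R V Y" for X Y X' Y'
    using that(6)
  proof
    assume "\<not> par V Q V X \<and> \<not> par V Q V Y"
    then show ?thesis
      using desargues_center[of V X Q Y X' Q' Y'] that assms(2) col_perm par_flips unfolding good_def
      by metis
  next
    assume "\<not> par V R V X \<and> \<not> par V R V Y"
    then show ?thesis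
      using desargues_center[of V X R Y X' R' Y'] that R'(1) col_perm par_flips unfolding good_def
      by metis
  qed
  have split: "par X Y X' Y'"
    if h: "good X X'" "good Y Y'" "X \<in> \<P>" "Y \<in> \<P>" "\<not> par V X V Y" "par V Q V X" "par V R V Y" for X Y X' Y'
  proof -
    obtain S where S: "S \<in> \<P>" "\<not> par V Q V S" "\<not> par V R V S" using ex_third R pts by metis
    obtain S' where S': "good S S'" using ex S by metis
    have nV: "X \<noteq> V" "Y \<noteq> V" using h not_par_ne pts by metis+
    have "\<not> par V X V R" "\<not> par V X V S" "\<not> par V Y V Q" "\<not> par V Y V S"
      using S R h nV par_trans par_sym by metis+
    then have "par X S X' S'" "par S Y S' Y'"
      using via[OF h(1) S' h(3) S(1)] via[OF S' h(2) S(1) h(4)] S par_sym by blast+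
    then show ?thesis using desargues_center[of V X S Y X' S' Y'] h S'
      \<open>\<not> par V X V S\<close> \<open>\<not> par V Y V S\<close> par_sym unfolding good_def by blast
  qed
  have main: "par X Y X' Y'" if h: "good X X'" "good Y Y'" "X \<in> \<P>" "Y \<in> \<P>" for X Y X' Y'
  proof (cases "par V X V Y")
    case True
    show ?thesis
    proof (cases "X = V \<or> Y = V")
      case True
      then show ?thesis using h unfolding good_def by (metis par_flips)
    next
      case False
      then have "par V X V X'" "par V X V Y'" using True h par_trans unfolding good_def by metis+
      then show ?thesis using on_line[of V X] False True par_refl pts h by metis
    qed
  next
    case False
    then have "X \<noteq> V" "Y \<noteq> V" using h not_par_ne pts by metis+
    then have "\<not> (par V Q V X \<and> par V R V X)" "\<not> (par V Q V Y \<and> par V R V Y)"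
      using R(2) par_trans par_sym by metis+
    then show ?thesis using via[OF h False] split[OF h False] split[OF h(2,1,4,3)] False par_flips by metis
  qed
  obtain f where "\<forall>X\<in>\<P>. good X (f X)" using ex by metis
  then show ?thesis using main pts unfolding dilatation_def good_def by metis
qed

section \<open>Translations taking one point to another\<close>

lemma parallel_construct:
  assumes "P \<noteq> Q" "\<not> par P Q P R" "par P Q R S" "par P R Q S"
    and "X \<in> \<P>" "\<not> par P Q P X"
  shows "\<exists>X'. X \<noteq> X' \<and> par P Q X X' \<and> par P X Q X' \<and> par R X S X'"
proof -
  have pts: "P \<in> \<P>" "Q \<in> \<P>" "S \<in> \<P>" "R \<in> \<P>" using assms par_points by metis+
  obtain X' where X': "par P Q X X'" "par P X Q X'" using par_meet pts assms by metis
  have ne: "X \<noteq> X'" "R \<noteq> S" using assms X' col_perm par_flips by metis+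
  \<comment> \<open>\<open>X'\<close> completes the parallelogram on \<open>P Q\<close> and
    \<open>P X\<close>; Desargues shows that it also fits \<open>R S\<close>. For \<open>X\<close>
    on \<open>R S\<close> both pairs lie on that line.\<close>
  have "par R X S X'"
  proof (cases "par P Q R X")
    case True
    then have "par P Q S X'" using X' assms(1,3) line_ext par_flips by metis
    then show ?thesis using True assms(1) par_trans par_sym by metis
  next
    case False
    have "\<not> par R S R P" "\<not> par R S R X" "\<not> par R S P X"
      using False ne assms par_trans par_flips col_perm line_ext by metis+
    then show ?thesis
      using desargues_parallel[of R S P X Q X'] ne X' assms par_trans par_flips by metis
  qed
  then show ?thesis using X' ne by blast
qed

text \<open>Two parallel lines cover the plane only when it has order two. In that case there is no third
  parallel line for the construction of translations, so these planes are treated by hand.\<close>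

lemma order2_line:
  assumes "P \<noteq> Q" "\<not> par P Q P R" "\<And>T. T \<in> \<P> \<Longrightarrow> par P Q P T \<or> par P Q R T"
   "P \<in> \<P>" "Q \<in> \<P>" "R \<in> \<P>" "par P Q P Z"
  shows "Z = P \<or> Z = Q"
proof (rule ccontr)
  assume Z: "\<not> (Z = P \<or> Z = Q)"
  have Zp: "Z \<in> \<P>" using assms par_points by metis
  have n1: "\<not> par Q R P Q" using assms(2) col_perm par_flips by metis
  \<comment> \<open>\<open>W\<close> is the fourth vertex of the parallelogram with consecutive
    vertices \<open>P\<close>, \<open>Q\<close>, \<open>R\<close>.\<close>
  then obtain W where W: "par Q R P W" "par P Q R W" using assms par_meet by metis
  have Wp: "W \<in> \<P>" using W par_points by metis
  have WR: "W \<noteq> R" using W(1) assms(2) col_perm par_flips by metis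
  have QR: "Q \<noteq> R" "P \<noteq> R" using assms(2) assms(4-6) par_refl par_triv' by metis+
  have Woff: "\<not> par P Q P W" "\<not> par P Q Z W"
    using W(2) assms(1,2,7) line_ext par_flips by metis+
  \<comment> \<open>Otherwise \<open>Z W\<close> meets \<open>Q R\<close> on one of the two covering
    lines, hence at \<open>Q\<close> or \<open>R\<close>; this would put \<open>W\<close> on
    \<open>P Q\<close> or \<open>Z\<close> on the parallel \<open>R W\<close>.\<close>
  have "par Q R Z W"
  proof (rule ccontr)
    assume "\<not> par Q R Z W"
    then obtain V where V: "par Q R Q V" "par Z W Z V" using par_meet assms Zp Wp by metis
    have Vp: "V \<in> \<P>" using V par_points by metis
    have "par P Q P V \<or> par P Q R V" using assms Vp by metis
    then show False
    proof
      assume "par P Q P V"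
      then have "V = Q" using par_unique[of Q R Q V Q P Q P] V(1) n1 assms(4-6) par_triv' par_flips col_perm par_refl by metis
      then show False using V(2) Woff Z assms(7) par_trans par_flips col_perm by metis
    next
      assume "par P Q R V"
      then have "V = R" using par_unique[of Q R R V R P Q R] V(1) n1 assms(4-6) par_triv' par_flips col_perm par_refl by metis
      then have "par W R W Z" using V(2) col_perm by metis
      then show False using W(2) WR assms(1,7) Woff par_trans par_flips by metis
    qed
  qed
  \<comment> \<open>\<open>P W\<close> and \<open>Z W\<close> are both parallel to
    \<open>Q R\<close> and share \<open>W\<close>, so they coincide; with
    \<open>Z \<noteq> P\<close> this puts \<open>W\<close> on \<open>P Q\<close>.\<close>
  then have "par W P W Z" using W(1) QR par_trans par_flips by metis
  then have "par P Z P W" using col_perm by metis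
  then show False using Z assms(7) Woff par_trans by metis
qed

text \<open>A common point of the diagonals would lie on \<open>P Q\<close> or on
  \<open>R S\<close>, but the diagonals reach either line at different vertices.\<close>

lemma order2_diagonal:
  assumes "P \<noteq> Q" "\<not> par P Q P R" "par P Q R S" "R \<noteq> S"
    and "\<And>T. T \<in> \<P> \<Longrightarrow> par P Q P T \<or> par P Q R T"
  shows "par P S Q R"
proof (rule ccontr)
  assume n: "\<not> par P S Q R"
  have pts: "P \<in> \<P>" "Q \<in> \<P>" "S \<in> \<P>" "R \<in> \<P>" using assms par_points by metis+
  have off: "\<not> par P S P Q" "\<not> par Q R P Q"
    using assms(1-3) col_perm par_flips line_ext by metis+
  moreover have "par P Q P S" if "par P S R S"
    using that assms(3,4) par_flips par_trans by metis
  ultimately have off3: "\<not> par P S R S" using par_sym by metis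
  obtain V where V: "par P S P V" "par Q R Q V" using par_meet n pts by metis
  then have "V \<in> \<P>" using par_points by metis
  then consider "par P Q P V" | "par P Q R V" using assms by metis
  then show False
  proof cases
    case 1
    then have "V = P" using par_unique[of P S P V P P Q P] V(1) off pts par_triv' by metis
    then show False using V off par_flips by metis
  next
    case 2
    then have "par R S R V" "par R S S V" using assms par_trans par_sym par_col by metis+
    then have "V = S" "V = R"
      using par_unique[of P S S V S R S S] par_unique[of Q R R V R P Q R] 2 V off off3 pts par_triv' par_flips col_perm par_col by metis+
    then show False using assms by metis
  qed
qed

text \<open>Points off \<open>P Q\<close> take their image from the pair \<open>P\<close>,
  \<open>Q\<close>, points on it from the parallel pair \<open>R\<close>, \<open>S\<close>. A third
  parallel line mediates between the two, unless the plane has order two.\<close>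

lemma ex_translation_ne:
  assumes "P \<noteq> Q" "P \<in> \<P>" "Q \<in> \<P>"
  shows "\<exists>\<tau>. translation \<tau> \<and> \<tau> P = Q"
proof -
  obtain R where R: "R \<in> \<P>" "\<not> par P Q P R" using ex_off assms by metis
  obtain S where S: "par P Q R S" "par P R Q S" using par_meet R assms by metis
  have Sp: "S \<in> \<P>" using S par_points by metis
  have ne: "R \<noteq> S" using S R col_perm par_flips by metis
  have off: "\<not> par R S R P" using S R assms ne par_flips par_trans by metis
  \<comment> \<open>The clause \<open>X \<noteq> X'\<close> keeps traces nondegenerate, as Desargues
    requires, and identifies the images in the plane of order two.\<close>
  define good where "good X X' \<longleftrightarrow> X \<noteq> X' \<and> (X = P \<longrightarrow> X' = Q) \<and>
    par P Q X X' \<and> par P X Q X' \<and> par R X S X'" for X X'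
  have ex: "\<exists>X'. good X X'" if X: "X \<in> \<P>" for X
  proof -
    consider "X = P" | "X \<noteq> P" "\<not> par P Q P X" | "X \<noteq> P" "par P Q P X" by blast
    then show ?thesis
    proof cases
      case 1
      then have "good X Q" unfolding good_def using assms S par_flips par_triv par_refl by metis
      then show ?thesis by blast
    next
      case 2
      then show ?thesis unfolding good_def
        using parallel_construct[OF assms(1) R(2) S X] by metis
    next
      case 3
      then have "\<not> par R S R X" using S(1) R(2) ne line_ext par_trans par_flips assms(1) by metis
      moreover have "par R S P Q" "par R P S Q" using S par_flips by metis+
      ultimately obtain X' where "X \<noteq> X' \<and> par R S X X' \<and> par R X S X' \<and> par P X Q X'"
        using parallel_construct[OF ne off _ _ X] by metis
      then show ?thesis unfolding good_def using 3 S(1) ne par_trans by metis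
    qed
  qed
  have D: "par X Y X' Y'" if "X \<noteq> X'" "par P Q X X'" "par P Q Y Y'" "par P Q Z Z'"
    "\<not> par P Q X Z" "\<not> par P Q X Y" "\<not> par P Q Z Y" "par X Z X' Z'" "par Z Y Z' Y'" for X X' Y Y' Z Z'
    using desargues_parallel[of X X' Z Y Z' Y'] that assms(1) par_trans par_sym by metis
  have via: "par X Y X' Y'"
    if "good X X'" "good Y Y'" "X \<in> \<P>" "Y \<in> \<P>" "\<not> par P Q X Y"
     "\<not> par P Q P X \<and> \<not> par P Q P Y \<or> \<not> par P Q R X \<and> \<not> par P Q R Y" for X Y X' Y'
    using that(6)
  proof
    assume "\<not> par P Q P X \<and> \<not> par P Q P Y"
    then show ?thesis
      using D[of X X' Y Y' P Q] that par_flips par_refl assms unfolding good_def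
      by metis
  next
    assume "\<not> par P Q R X \<and> \<not> par P Q R Y"
    then show ?thesis
      using D[of X X' Y Y' R S] that par_flips S unfolding good_def
      by metis
  qed
  have split: "par X Y X' Y'"
    if h: "good X X'" "good Y Y'" "X \<in> \<P>" "Y \<in> \<P>" "\<not> par P Q X Y" "par P Q P X" "par P Q R Y" for X Y X' Y'
  proof (cases "\<exists>T\<in>\<P>. \<not> par P Q P T \<and> \<not> par P Q R T")
    case True
    then obtain T where T: "T \<in> \<P>" "\<not> par P Q P T" "\<not> par P Q R T" by blast
    obtain T' where T': "good T T'" using ex T by metis
    have n: "\<not> par P Q X R" "\<not> par P Q X T" "\<not> par P Q Y P" "\<not> par P Q T Y"
      using T R(2) h assms(1) line_ext par_flips by metis+
    then have "par X T X' T'" "par T Y T' Y'"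
      using via[OF h(1) T' h(3) T(1)] via[OF T' h(2) T(1) h(4)] T par_flips by metis+
    then show ?thesis using D[of X X' Y Y' T T'] n h T' unfolding good_def by metis
  next
    case False
    then have c: "\<And>T. T \<in> \<P> \<Longrightarrow> par P Q P T \<or> par P Q R T" by blast
    then have c': "\<And>T. T \<in> \<P> \<Longrightarrow> par R S R T \<or> par R S P T"
      using S(1) assms(1) par_sym par_trans by metis
    have l: "X = P \<or> X = Q" "Y = R \<or> Y = S"
      using order2_line[OF assms(1) R(2) c assms(2,3) R(1) h(6)]
        order2_line[OF ne off c' R(1) Sp assms(2)] h(7) S(1) assms(1) par_sym par_trans by metis+
    have "par P Q P X'" "par P Q R Y'" using h assms(1) line_ext unfolding good_def by metis+
    then have l': "X' = P \<or> X' = Q" "Y' = R \<or> Y' = S"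
      using order2_line[OF assms(1) R(2) c assms(2,3) R(1)]
        order2_line[OF ne off c' R(1) Sp assms(2)] S(1) assms(1) par_sym par_trans by metis+
    have "X \<noteq> X'" "Y \<noteq> Y'" using h unfolding good_def by auto
    \<comment> \<open>Passing to images swaps \<open>P\<close> with \<open>Q\<close> and
      \<open>R\<close> with \<open>S\<close>, so \<open>X Y\<close> goes to the opposite side or to
      the other diagonal.\<close>
    moreover have "par P S Q R" using order2_diagonal[OF assms(1) R(2) S(1) ne c] .
    ultimately show ?thesis using l l' S(2) par_flips by metis
  qed
  have main: "par X Y X' Y'" if h: "good X X'" "good Y Y'" "X \<in> \<P>" "Y \<in> \<P>" for X Y X' Y'
  proof (cases "par P Q X Y")
    case True
    then have "par P Q X' Y'" using h assms(1) line_ext par_flips unfolding good_def by metis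
    then show ?thesis using True par_sym par_trans assms(1) by metis
  next
    case False
    then have "\<not> (par P Q P X \<and> par P Q R X)" "\<not> (par P Q P Y \<and> par P Q R Y)"
      using R(2) line_ext par_flips assms(1) by metis+
    then show ?thesis using via[OF h False] split[OF h False] split[OF h(2,1,4,3)] False par_flips by metis
  qed
  obtain f where f: "\<forall>X\<in>\<P>. good X (f X)" using ex by metis
  have "par X (f X) Y (f Y)" if "X \<in> \<P>" "Y \<in> \<P>" for X Y
    using f that assms(1) par_trans[OF par_sym, of P Q] unfolding good_def by blast
  then have "translation f" unfolding translation_def dilatation_def
    using main f by blast
  then show ?thesis using f assms unfolding good_def by metis
qed

section \<open>Dilatations and the group of translations\<close>

lemma dilatationD: "\<lbrakk>dilatation \<sigma>; X \<in> \<P>; Y \<in> \<P>\<rbrakk> \<Longrightarrow> par X Y (\<sigma> X) (\<sigma> Y)"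
  unfolding dilatation_def by blast

lemma dilatation_closed: "\<lbrakk>dilatation \<sigma>; X \<in> \<P>\<rbrakk> \<Longrightarrow> \<sigma> X \<in> \<P>"
  using dilatationD par_points by blast

lemma translationD: "\<lbrakk>translation \<tau>; X \<in> \<P>; Y \<in> \<P>\<rbrakk> \<Longrightarrow> par X (\<tau> X) Y (\<tau> Y)"
  unfolding translation_def by blast

lemma translation_dilatation: "translation \<tau> \<Longrightarrow> dilatation \<tau>"
  unfolding translation_def by blast

lemma translation_closed: "\<lbrakk>translation \<tau>; X \<in> \<P>\<rbrakk> \<Longrightarrow> \<tau> X \<in> \<P>"
  using translation_dilatation dilatation_closed by blast

lemma dilatation_comp:
  assumes "dilatation \<sigma>" "dilatation \<rho>"
  shows "dilatation (\<lambda>X. \<sigma> (\<rho> X))"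
  unfolding dilatation_def
proof (intro ballI)
  fix X Y assume XY: "X \<in> \<P>" "Y \<in> \<P>"
  show "par X Y (\<sigma> (\<rho> X)) (\<sigma> (\<rho> Y))"
  \<comment> \<open>\<open>\<rho>\<close> may be constant, and a degenerate middle pair breaks
    transitivity.\<close>
  proof (cases "\<rho> X = \<rho> Y")
    case True
    then show ?thesis using XY assms dilatation_closed par_triv' by metis
  next
    case False
    then show ?thesis using XY assms dilatation_closed dilatationD par_trans by metis
  qed
qed

lemma translation_id: "translation (\<lambda>X. X)"
  unfolding translation_def dilatation_def using par_refl par_triv by blast

text \<open>Off the line \<open>P Q\<close> the image of \<open>X\<close> is the meet of two
  parallels through known images; a point \<open>R\<close> off the line then reaches the points on
  it.\<close>

lemma dilatation_eq:
  assumes "dilatation \<sigma>" "dilatation \<rho>" "P \<in> \<P>" "Q \<in> \<P>" "P \<noteq> Q" "\<sigma> P = \<rho> P" "\<sigma> Q = \<rho> Q" "X \<in> \<P>"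
  shows "\<sigma> X = \<rho> X"
proof -
  have off: "\<sigma> X = \<rho> X" if "P \<in> \<P>" "Q \<in> \<P>" "\<sigma> P = \<rho> P" "\<sigma> Q = \<rho> Q" "X \<in> \<P>" "\<not> par P Q P X" for P Q X
  proof (rule par_unique)
    show "par P X (\<sigma> P) (\<sigma> X)" "par P X (\<sigma> P) (\<rho> X)" "par Q X (\<sigma> Q) (\<sigma> X)" "par Q X (\<sigma> Q) (\<rho> X)"
      using that assms(1,2) dilatationD by metis+
    show "\<not> par P X Q X" using that(6) col_perm par_flips by metis
  qed
  obtain R where R: "R \<in> \<P>" "\<not> par P Q P R" using ex_off assms by metis
  then have "\<sigma> R = \<rho> R" using off assms by metis
  then show ?thesis using off[of P Q X] off[of P R X] R assms par_trans par_sym by metis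
qed

text \<open>If \<open>X\<close> moved, all traces would be parallel to \<open>P X\<close>. But a
  point \<open>S\<close> off \<open>P X\<close> also stays on \<open>P S\<close>, so it is fixed,
  and two fixed points force the identity.\<close>

lemma translation_fixed:
  assumes "translation \<tau>" "P \<in> \<P>" "\<tau> P = P" "X \<in> \<P>"
  shows "\<tau> X = X"
proof (rule ccontr)
  assume X: "\<tau> X \<noteq> X"
  then have "P \<noteq> X" using assms by auto
  then obtain S where S: "S \<in> \<P>" "\<not> par P X P S" using ex_off assms by metis
  have d: "dilatation \<tau>" using assms(1) translation_dilatation by blast
  have "par P X X (\<tau> X)" using dilatationD[OF d assms(2,4)] assms(3) par_col by metis
  then have "par P X S (\<tau> S)" using translationD[OF assms(1,4) S(1)] X par_trans by metis
  moreover have "par P S P (\<tau> S)" using dilatationD[OF d assms(2) S(1)] assms(3) by metis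
  ultimately have "\<tau> S = S"
    using par_unique[of P X S "\<tau> S" S P S P] S assms par_triv' par_refl by metis
  then have "\<tau> X = X"
    using dilatation_eq[OF d translation_dilatation[OF translation_id], of P S X] S assms not_par_ne by metis
  then show False using X by simp
qed

text \<open>If \<open>P\<close> moves, the image of a point \<open>R\<close> off its trace is the
  fourth vertex of a parallelogram, and two values determine a dilatation.\<close>

lemma translation_eq:
  assumes "translation \<tau>" "translation \<rho>" "P \<in> \<P>" "\<tau> P = \<rho> P" "X \<in> \<P>"
  shows "\<tau> X = \<rho> X"
proof (cases "\<tau> P = P")
  case True
  then show ?thesis using translation_fixed assms by metis
next
  case False
  have d: "dilatation \<tau>" "dilatation \<rho>" using assms translation_dilatation by auto
  obtain R where R: "R \<in> \<P>" "\<not> par P (\<tau> P) P R"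
    using ex_off False assms translation_closed by metis
  have "\<tau> R = \<rho> R"
    using par_unique[of P "\<tau> P" R "\<tau> R" "\<rho> R" P R "\<tau> P"] R assms translationD d dilatationD by metis
  moreover have "P \<noteq> R" using R assms not_par_ne translation_closed by metis
  ultimately show ?thesis using dilatation_eq[OF d] assms R by metis
qed

lemma ex_translation:
  assumes "P \<in> \<P>" "Q \<in> \<P>"
  shows "\<exists>\<tau>. translation \<tau> \<and> \<tau> P = Q"
  using ex_translation_ne assms translation_id by metis

text \<open>Traces are invariant lines, so two nonparallel ones would meet in a fixed point.\<close>

lemma fixfree_translation:
  assumes "dilatation \<sigma>" "\<And>X. X \<in> \<P> \<Longrightarrow> \<sigma> X \<noteq> X"
  shows "translation \<sigma>"
proof -
  have trace: "par X (\<sigma> X) X (\<sigma> V)" if "X \<in> \<P>" "par X (\<sigma> X) X V" for X V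
  proof -
    have V: "V \<in> \<P>" using that par_points by metis
    show ?thesis
    proof (cases "V = X")
      case True
      then show ?thesis using that assms dilatation_closed par_refl by metis
    next
      case False
      have "par X V X (\<sigma> V)"
        using line_ext[of X V X "\<sigma> X" "\<sigma> V"] dilatationD[OF assms(1) that(1) V] that(2) False par_sym by metis
      then show ?thesis using that(2) False par_trans by metis
    qed
  qed
  have "par X (\<sigma> X) Y (\<sigma> Y)" if XY: "X \<in> \<P>" "Y \<in> \<P>" for X Y
  proof (rule ccontr)
    assume n: "\<not> par X (\<sigma> X) Y (\<sigma> Y)"
    then obtain V where V: "par X (\<sigma> X) X V" "par Y (\<sigma> Y) Y V"
      using par_meet XY dilatation_closed[OF assms(1)] by metis
    then have "V \<in> \<P>" using par_points by metis
    moreover have "\<sigma> V = V" using par_unique[OF trace[OF XY(1) V(1)] V(1) trace[OF XY(2) V(2)] V(2) n] .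
    ultimately show False using assms by metis
  qed
  then show ?thesis unfolding translation_def using assms by blast
qed

text \<open>Closure under composition rests on this lemma, so the return of a second point
  \<open>R\<close> is read off from the parallelogram \<open>P\<close>, \<open>Q\<close>,
  \<open>\<tau> R\<close>, \<open>R\<close> instead.\<close>

lemma translation_inverse:
  assumes "translation \<tau>" "translation \<tau>'" "P \<in> \<P>" "\<tau>' (\<tau> P) = P" "X \<in> \<P>"
  shows "\<tau>' (\<tau> X) = X"
proof (cases "\<tau> P = P")
  case True
  then show ?thesis using translation_fixed assms by metis
next
  case False
  define Q where "Q = \<tau> P"
  have Q: "Q \<in> \<P>" "P \<noteq> Q" "\<tau> P = Q" "\<tau>' Q = P" using assms translation_closed False Q_def by auto
  have d: "dilatation \<tau>" "dilatation \<tau>'" using assms translation_dilatation by auto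
  obtain R where R: "R \<in> \<P>" "\<not> par P Q P R" using ex_off Q assms by metis
  have S: "\<tau> R \<in> \<P>" "par P Q R (\<tau> R)" "par P R Q (\<tau> R)"
    using translation_closed translationD dilatationD d assms R Q by metis+
  have S': "par P Q (\<tau> R) (\<tau>' (\<tau> R))" "par Q (\<tau> R) P (\<tau>' (\<tau> R))"
    using translationD[OF assms(2) Q(1) S(1)] dilatationD[OF d(2) Q(1) S(1)] Q par_swap by metis+
  have n: "\<not> par P Q Q (\<tau> R)"
    using R S Q col_perm par_flips par_trans by metis
  have "\<tau>' (\<tau> R) = R"
    using par_unique[of P Q "\<tau> R" _ _ Q "\<tau> R" P] S S' n par_flips by metis
  moreover have "P \<noteq> R" using R not_par_ne assms(3) Q(1) by metis
  ultimately show ?thesis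
    using dilatation_eq[OF dilatation_comp[OF d(2,1)] translation_dilatation[OF translation_id], of P R X]
      assms R by metis
qed

text \<open>A composite with a fixed point is the identity on points by
  \<open>translation_inverse\<close>; one without falls under
  \<open>fixfree_translation\<close>.\<close>

lemma translation_comp:
  assumes "translation \<tau>" "translation \<rho>"
  shows "translation (\<lambda>X. \<tau> (\<rho> X))"
proof (cases "\<exists>P\<in>\<P>. \<tau> (\<rho> P) = P")
  case True
  then have "\<And>X. X \<in> \<P> \<Longrightarrow> \<tau> (\<rho> X) = X" using translation_inverse assms by metis
  then show ?thesis using translation_id unfolding translation_def dilatation_def by auto
next
  case False
  then show ?thesis
    using fixfree_translation dilatation_comp assms translation_dilatation by metis
qed

lemma ex_inverse_translation:
  assumes "translation \<tau>"
  shows "\<exists>\<tau>'. translation \<tau>' \<and> (\<forall>X\<in>\<P>. \<tau>' (\<tau> X) = X)"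
proof -
  obtain P where P: "P \<in> \<P>" using points_nonempty by blast
  then obtain \<tau>' where "translation \<tau>'" "\<tau>' (\<tau> P) = P"
    using ex_translation assms translation_closed by metis
  then show ?thesis using translation_inverse[OF assms] P by metis
qed

lemma translation_inj:
  assumes "translation \<tau>" "X \<in> \<P>" "Y \<in> \<P>" "\<tau> X = \<tau> Y"
  shows "X = Y"
  using ex_inverse_translation assms by metis

text \<open>Both composites send \<open>P\<close> to the fourth vertex of the parallelogram on
  \<open>\<tau> P\<close> and \<open>\<rho> P\<close>, and a translation is determined by one
  value.\<close>

lemma translation_commute_off:
  assumes "translation \<tau>" "translation \<rho>" "P \<in> \<P>" "\<not> par P (\<tau> P) P (\<rho> P)" "X \<in> \<P>"
  shows "\<tau> (\<rho> X) = \<rho> (\<tau> X)"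
proof -
  have c: "\<tau> P \<in> \<P>" "\<rho> P \<in> \<P>" using assms translation_closed by auto
  have "\<tau> (\<rho> P) = \<rho> (\<tau> P)"
  proof (rule par_unique)
    show "par P (\<tau> P) (\<rho> P) (\<tau> (\<rho> P))" "par P (\<rho> P) (\<tau> P) (\<rho> (\<tau> P))"
      using assms c translationD by blast+
    show "par P (\<tau> P) (\<rho> P) (\<rho> (\<tau> P))" "par P (\<rho> P) (\<tau> P) (\<tau> (\<rho> P))"
      using assms c translation_dilatation dilatationD by blast+
  qed (use assms in blast)
  then show ?thesis using translation_eq[OF translation_comp translation_comp] assms by metis
qed

text \<open>Translations in the same direction are compared through a translation in another one.\<close>

lemma translation_commute:
  assumes "translation \<tau>" "translation \<rho>" "X \<in> \<P>"
  shows "\<tau> (\<rho> X) = \<rho> (\<tau> X)"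
proof (cases "\<tau> X = X")
  case True
  then show ?thesis using translation_fixed assms translation_closed by metis
next
  case ne: False
  show ?thesis
  proof (cases "par X (\<tau> X) X (\<rho> X)")
    case False
    then show ?thesis using translation_commute_off assms by metis
  next
    case True
    have c: "\<tau> X \<in> \<P>" "\<rho> X \<in> \<P>" using assms translation_closed by auto
    obtain Z where Z: "Z \<in> \<P>" "\<not> par X (\<tau> X) X Z" using ex_off assms c ne by metis
    obtain \<chi> where \<chi>: "translation \<chi>" "\<chi> X = Z" using ex_translation assms Z by metis
    have tr: "par X Z (\<rho> X) (\<chi> (\<rho> X))" using translationD \<chi> assms c by metis
    have neZ: "\<chi> (\<rho> X) \<noteq> \<rho> X" using translation_fixed \<chi> Z not_par_ne assms c by metis
    have "\<not> par X (\<tau> X) X (\<chi> (\<rho> X))"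
    proof
      assume "par X (\<tau> X) X (\<chi> (\<rho> X))"
      then have "par X (\<tau> X) (\<rho> X) (\<chi> (\<rho> X))" using True line_ext ne par_flips by metis
      then show False using tr neZ Z(2) par_trans par_sym by metis
    qed
    \<comment> \<open>\<open>\<tau>\<close> commutes with \<open>\<chi>\<close> and with
      \<open>\<chi>\<close> after \<open>\<rho>\<close>, both being in other directions;
      \<open>\<chi>\<close> is then cancelled.\<close>
    then have "\<tau> (\<chi> (\<rho> X)) = \<chi> (\<rho> (\<tau> X))"
      using translation_commute_off[OF assms(1) translation_comp[OF \<chi>(1) assms(2)] assms(3)] assms(3) by metis
    moreover have "\<tau> (\<chi> (\<rho> X)) = \<chi> (\<tau> (\<rho> X))"
      using translation_commute_off[OF assms(1) \<chi>(1) assms(3)] Z \<chi> c by metis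
    ultimately show ?thesis using translation_inj \<chi>(1) translation_closed assms c by metis
  qed
qed

end

section \<open>Vector addition and scalings\<close>

locale desargues_frame = desargues_affine_plane +
  fixes O\<^sub>0 I
  assumes O_point [simp]: "O\<^sub>0 \<in> \<P>" and I_point [simp]: "I \<in> \<P>" and O_ne_I: "O\<^sub>0 \<noteq> I"
begin

text \<open>The choice does not matter on \<open>\<P>\<close>, since a translation is determined by
  one value.\<close>

definition transl where "transl X = (SOME \<tau>. translation \<tau> \<and> \<tau> O\<^sub>0 = X)"

definition plus (infixl "\<boxplus>" 65) where "X \<boxplus> Y = transl X Y"

lemma transl: "X \<in> \<P> \<Longrightarrow> translation (transl X)" "X \<in> \<P> \<Longrightarrow> transl X O\<^sub>0 = X"
  unfolding transl_def using someI_ex[OF ex_translation[OF O_point]] by blast+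

lemma plus_closed [simp]: "\<lbrakk>X \<in> \<P>; Y \<in> \<P>\<rbrakk> \<Longrightarrow> X \<boxplus> Y \<in> \<P>"
  unfolding plus_def using transl translation_closed by blast

lemma plus_O [simp]: "X \<in> \<P> \<Longrightarrow> X \<boxplus> O\<^sub>0 = X"
  unfolding plus_def using transl by blast

lemma O_plus [simp]: "X \<in> \<P> \<Longrightarrow> O\<^sub>0 \<boxplus> X = X"
  unfolding plus_def using transl translation_fixed O_point by blast

lemma plus_commute: "\<lbrakk>X \<in> \<P>; Y \<in> \<P>\<rbrakk> \<Longrightarrow> X \<boxplus> Y = Y \<boxplus> X"
  unfolding plus_def using transl translation_commute O_point by metis

text \<open>Both sides are values at \<open>Z\<close> of translations that agree at
  \<open>O\<^sub>0\<close>.\<close>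

lemma plus_assoc:
  assumes "X \<in> \<P>" "Y \<in> \<P>" "Z \<in> \<P>"
  shows "(X \<boxplus> Y) \<boxplus> Z = X \<boxplus> (Y \<boxplus> Z)"
proof -
  have "transl (transl X Y) Z = transl X (transl Y Z)"
    using translation_eq[OF transl(1) translation_comp[OF transl(1)[OF assms(1)] transl(1)[OF assms(2)]],
      OF _ O_point _ assms(3)] transl translation_closed assms by metis
  then show ?thesis unfolding plus_def .
qed

lemma ex_minus:
  assumes "X \<in> \<P>"
  shows "\<exists>Y\<in>\<P>. Y \<boxplus> X = O\<^sub>0"
proof -
  obtain \<tau>' where \<tau>': "translation \<tau>'" "\<tau>' X = O\<^sub>0" using ex_inverse_translation transl assms O_point by metis
  define Y where "Y = \<tau>' O\<^sub>0"
  have "Y \<in> \<P>" using Y_def \<tau>' translation_closed O_point by metis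
  moreover have "Y \<boxplus> X = O\<^sub>0" unfolding plus_def
    using translation_eq[OF transl(1)[OF \<open>Y \<in> \<P>\<close>] \<tau>'(1) O_point _ assms] transl \<open>Y \<in> \<P>\<close> Y_def \<tau>' by metis
  ultimately show ?thesis by blast
qed

lemma plus_cancel: "\<lbrakk>X \<in> \<P>; Y \<in> \<P>; Z \<in> \<P>\<rbrakk> \<Longrightarrow> X \<boxplus> Z = Y \<boxplus> Z \<longleftrightarrow> X = Y"
  using plus_commute translation_inj transl unfolding plus_def by metis

text \<open>The parallelogram rule: \<open>transl X\<close> carries \<open>O\<^sub>0\<close> and
  \<open>Y\<close> to \<open>X\<close> and \<open>X \<boxplus> Y\<close>.\<close>

lemma par_plus: "\<lbrakk>X \<in> \<P>; Y \<in> \<P>\<rbrakk> \<Longrightarrow> par O\<^sub>0 Y X (X \<boxplus> Y)"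
  unfolding plus_def using transl translation_dilatation dilatationD O_point by metis

lemma par_plus_on:
  assumes "par O\<^sub>0 D O\<^sub>0 X" "Y \<in> \<P>"
  shows "par O\<^sub>0 D Y (Y \<boxplus> X)"
proof (cases "X = O\<^sub>0")
  case True
  then show ?thesis using assms par_points par_triv' plus_O by metis
next
  case False
  then show ?thesis using assms par_plus par_trans par_points by metis
qed

lemma line_plus: "\<lbrakk>par O\<^sub>0 D O\<^sub>0 X; par O\<^sub>0 D O\<^sub>0 Y; O\<^sub>0 \<noteq> D\<rbrakk> \<Longrightarrow> par O\<^sub>0 D O\<^sub>0 (X \<boxplus> Y)"
  using line_ext par_plus_on par_points by metis

section \<open>Dilatations fixing the origin\<close>

definition scaling where "scaling \<sigma> \<longleftrightarrow> dilatation \<sigma> \<and> \<sigma> O\<^sub>0 = O\<^sub>0"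

lemma scaling_closed [simp]: "\<lbrakk>scaling \<sigma>; X \<in> \<P>\<rbrakk> \<Longrightarrow> \<sigma> X \<in> \<P>"
  unfolding scaling_def using dilatation_closed by blast

lemma scaling_par: "\<lbrakk>scaling \<sigma>; X \<in> \<P>\<rbrakk> \<Longrightarrow> par O\<^sub>0 X O\<^sub>0 (\<sigma> X)"
  unfolding scaling_def using dilatationD O_point by metis

lemma scaling_eq:
  assumes "scaling \<sigma>" "scaling \<rho>" "\<sigma> P = \<rho> P" "P \<in> \<P>" "P \<noteq> O\<^sub>0" "X \<in> \<P>"
  shows "\<sigma> X = \<rho> X"
  using dilatation_eq[of \<sigma> \<rho> P O\<^sub>0 X] assms unfolding scaling_def by simp

text \<open>\<open>X \<boxplus> Y\<close> is the fourth vertex of the parallelogram on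
  \<open>X\<close> and \<open>Y\<close>. A scaling keeps both directions, so its image is the fourth
  vertex over the images.\<close>

lemma scaling_plus_off:
  assumes s: "scaling \<sigma>" and off: "\<not> par O\<^sub>0 X O\<^sub>0 Y" and X: "X \<in> \<P>" and Y: "Y \<in> \<P>"
  shows "\<sigma> (X \<boxplus> Y) = \<sigma> X \<boxplus> \<sigma> Y"
proof -
  have d: "dilatation \<sigma>" using s scaling_def by blast
  have one: "par O\<^sub>0 X (\<sigma> Y) (\<sigma> (Y \<boxplus> X))" if "X \<in> \<P>" "Y \<in> \<P>" "X \<noteq> O\<^sub>0" for X Y
  proof -
    have "Y \<boxplus> X \<noteq> Y" using plus_cancel[of X O\<^sub>0 Y] plus_commute that by auto
    then show ?thesis using par_plus dilatationD d that plus_closed par_trans by metis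
  qed
  have two: "par O\<^sub>0 X (\<sigma> Y) (\<sigma> Y \<boxplus> \<sigma> X)" if "X \<in> \<P>" "Y \<in> \<P>" for X Y
    using par_plus_on scaling_par s that by simp
  have ne: "X \<noteq> O\<^sub>0" "Y \<noteq> O\<^sub>0" using off not_par_ne X Y O_point by metis+
  show ?thesis
  proof (rule par_unique[OF _ _ _ _ off])
    show "par O\<^sub>0 X (\<sigma> Y) (\<sigma> (X \<boxplus> Y))" "par O\<^sub>0 Y (\<sigma> X) (\<sigma> (X \<boxplus> Y))"
      using one X Y ne plus_commute by metis+
    show "par O\<^sub>0 X (\<sigma> Y) (\<sigma> X \<boxplus> \<sigma> Y)" "par O\<^sub>0 Y (\<sigma> X) (\<sigma> X \<boxplus> \<sigma> Y)"
      using two X Y plus_commute scaling_closed s by metis+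
  qed
qed

text \<open>When \<open>X\<close> and \<open>Y\<close> are collinear with the origin, add a third vector \<open>Z\<close> off their line and use
  the noncollinear case on both bracketings of \<open>X \<boxplus> Y \<boxplus> Z\<close>.\<close>

lemma scaling_plus:
  assumes s: "scaling \<sigma>" and X: "X \<in> \<P>" and Y: "Y \<in> \<P>"
  shows "\<sigma> (X \<boxplus> Y) = \<sigma> X \<boxplus> \<sigma> Y"
proof -
  have O: "\<sigma> O\<^sub>0 = O\<^sub>0" using s scaling_def by blast
  consider "X = O\<^sub>0" | "Y = O\<^sub>0" | "\<not> par O\<^sub>0 X O\<^sub>0 Y" | "par O\<^sub>0 X O\<^sub>0 Y" "X \<noteq> O\<^sub>0" "Y \<noteq> O\<^sub>0" by blast
  then show ?thesis
  proof cases
    case 4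
    obtain Z where Z: "Z \<in> \<P>" "\<not> par O\<^sub>0 X O\<^sub>0 Z" using ex_off X 4 O_point by metis
    have YZ: "\<not> par O\<^sub>0 Y O\<^sub>0 Z" using Z 4 par_trans by metis
    have "\<not> par O\<^sub>0 X O\<^sub>0 (Y \<boxplus> Z)"
    proof
      assume "par O\<^sub>0 X O\<^sub>0 (Y \<boxplus> Z)"
      moreover have "par O\<^sub>0 X Z (Y \<boxplus> Z)" using par_plus_on 4(1) Z plus_commute Y by metis
      ultimately show False using line_ext par_flips 4 Z by metis
    qed
    then have 1: "\<sigma> (X \<boxplus> (Y \<boxplus> Z)) = \<sigma> X \<boxplus> (\<sigma> Y \<boxplus> \<sigma> Z)"
      using scaling_plus_off s X Y Z YZ plus_closed by metis
    have 2: "\<sigma> ((X \<boxplus> Y) \<boxplus> Z) = \<sigma> (X \<boxplus> Y) \<boxplus> \<sigma> Z"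
    proof (cases "X \<boxplus> Y = O\<^sub>0")
      case True
      then show ?thesis using O Z s by simp
    next
      case False
      have "par O\<^sub>0 X O\<^sub>0 (X \<boxplus> Y)" using line_plus 4 par_refl X O_point by metis
      then have "\<not> par O\<^sub>0 (X \<boxplus> Y) O\<^sub>0 Z" using Z False par_trans by metis
      then show ?thesis using scaling_plus_off s X Y Z plus_closed by metis
    qed
    have "\<sigma> (X \<boxplus> Y) \<boxplus> \<sigma> Z = (\<sigma> X \<boxplus> \<sigma> Y) \<boxplus> \<sigma> Z"
      using 1 2 plus_assoc X Y Z s by simp
    then show ?thesis using plus_cancel X Y Z s by simp
  qed (use O X Y s scaling_plus_off in auto)
qed

text \<open>This is where right distributivity comes from.\<close>

lemma scaling_sum:
  assumes s: "scaling \<sigma>" and r: "scaling \<rho>"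
  shows "scaling (\<lambda>X. \<sigma> X \<boxplus> \<rho> X)"
proof -
  have "par X Y (\<sigma> X \<boxplus> \<rho> X) (\<sigma> Y \<boxplus> \<rho> Y)" if X: "X \<in> \<P>" and Y: "Y \<in> \<P>" for X Y
  proof -
    obtain X' where X': "X' \<in> \<P>" "X' \<boxplus> X = O\<^sub>0" using ex_minus X by metis
    \<comment> \<open>\<open>D\<close> is the difference of \<open>Y\<close> and \<open>X\<close>.
      By additivity the images differ by \<open>W\<close>, which lies on the line from the origin
      through \<open>D\<close>.\<close>
    define D where "D = X' \<boxplus> Y"
    have D: "D \<in> \<P>" using X' Y D_def by simp
    have "X \<boxplus> D = (X \<boxplus> X') \<boxplus> Y" unfolding D_def using plus_assoc X X' Y by simp
    then have Yeq: "Y = X \<boxplus> D" using X' X Y plus_commute by simp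
    define W where "W = \<sigma> D \<boxplus> \<rho> D"
    let ?S = "\<sigma> X \<boxplus> \<rho> X"
    have S: "?S \<in> \<P>" using s r X by simp
    have "\<sigma> Y \<boxplus> \<rho> Y = (\<sigma> X \<boxplus> \<sigma> D) \<boxplus> (\<rho> X \<boxplus> \<rho> D)"
      unfolding Yeq using scaling_plus s r X D by simp
    also have "\<dots> = \<sigma> X \<boxplus> (\<rho> X \<boxplus> (\<sigma> D \<boxplus> \<rho> D))"
      using plus_assoc plus_commute s r X D plus_closed scaling_closed by metis
    also have "\<dots> = ?S \<boxplus> W" unfolding W_def using plus_assoc s r X D by simp
    finally have eq: "\<sigma> Y \<boxplus> \<rho> Y = ?S \<boxplus> W" .
    show ?thesis
    proof (cases "D = O\<^sub>0")
      case True
      then have "X = Y" using Yeq X by simp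
      then show ?thesis using par_triv S X by simp
    next
      case False
      then have "par O\<^sub>0 D O\<^sub>0 W" unfolding W_def using line_plus scaling_par s r D by metis
      then have "par O\<^sub>0 D ?S (?S \<boxplus> W)" using par_plus_on S by metis
      moreover have "par O\<^sub>0 D X Y" using Yeq par_plus X D by metis
      ultimately show ?thesis using eq False par_trans par_sym by metis
    qed
  qed
  then show ?thesis using s r unfolding scaling_def dilatation_def by simp
qed

section \<open>The skew field of the line\<close>

definition axis where "axis = {X. par O\<^sub>0 I O\<^sub>0 X}"

lemma axis_point: "X \<in> axis \<Longrightarrow> X \<in> \<P>"
  unfolding axis_def using par_points by blast

lemma O_in_axis: "O\<^sub>0 \<in> axis" and I_in_axis: "I \<in> axis"
  unfolding axis_def using par_triv' par_refl by simp_all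

lemma axis_eq_line: "axis = line_through \<L> O\<^sub>0 I"
  unfolding axis_def using in_line_through_iff[OF O_point I_point O_ne_I] by blast

lemma plus_in_axis: "\<lbrakk>X \<in> axis; Y \<in> axis\<rbrakk> \<Longrightarrow> X \<boxplus> Y \<in> axis"
  unfolding axis_def using line_plus O_ne_I by blast

lemma ex_minus_axis:
  assumes "X \<in> axis"
  shows "\<exists>Y\<in>axis. Y \<boxplus> X = O\<^sub>0"
proof -
  obtain Y where Y: "Y \<in> \<P>" "Y \<boxplus> X = O\<^sub>0" using ex_minus axis_point assms by blast
  have "par O\<^sub>0 I Y O\<^sub>0" using par_plus_on[of I X Y] assms Y unfolding axis_def by simp
  then have "Y \<in> axis" unfolding axis_def using par_flips by blast
  then show ?thesis using Y by blast
qed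

section \<open>Multiplication of points\<close>

definition scal where "scal A = (SOME \<sigma>. scaling \<sigma> \<and> \<sigma> I = A)"

definition times (infixl "\<boxtimes>" 70) where "A \<boxtimes> B = scal A B"

lemma scal: "A \<in> axis \<Longrightarrow> scaling (scal A)" "A \<in> axis \<Longrightarrow> scal A I = A"
proof -
  assume "A \<in> axis"
  then have "\<exists>\<sigma>. scaling \<sigma> \<and> \<sigma> I = A"
    unfolding scaling_def axis_def using ex_central_dilatation[OF O_ne_I] by blast
  from someI_ex[OF this] show "scaling (scal A)" "scal A I = A" unfolding scal_def by blast+
qed

lemma scaling_in_axis:
  assumes "scaling \<sigma>" "X \<in> axis"
  shows "\<sigma> X \<in> axis"
proof (cases "X = O\<^sub>0")
  case True
  then show ?thesis using assms scaling_def by metis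
next
  case False
  then show ?thesis using assms scaling_par axis_point par_trans unfolding axis_def by blast
qed

text \<open>A scaling is determined by its value at \<open>I\<close>, so every scaling acts on the
  axis as a left multiplication. Several laws below come from a suitable choice of
  \<open>\<sigma>\<close>.\<close>

lemma times_eq:
  assumes "scaling \<sigma>" "B \<in> axis"
  shows "\<sigma> I \<boxtimes> B = \<sigma> B"
  unfolding times_def
  using scaling_eq[OF scal(1) assms(1) scal(2) I_point] scaling_in_axis[OF assms(1) I_in_axis] O_ne_I axis_point assms
  by metis

lemma times_in_axis: "\<lbrakk>A \<in> axis; B \<in> axis\<rbrakk> \<Longrightarrow> A \<boxtimes> B \<in> axis"
  unfolding times_def using scal scaling_in_axis by blast

lemma I_times: "A \<in> axis \<Longrightarrow> I \<boxtimes> A = A"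
  using times_eq[of "\<lambda>X. X"] translation_dilatation[OF translation_id] unfolding scaling_def by simp

lemma times_I: "A \<in> axis \<Longrightarrow> A \<boxtimes> I = A"
  unfolding times_def using scal by blast

lemma O_times: "A \<in> axis \<Longrightarrow> O\<^sub>0 \<boxtimes> A = O\<^sub>0"
  using times_eq[of "\<lambda>X. O\<^sub>0"] par_triv' unfolding scaling_def dilatation_def by simp

text \<open>The composite of two scalings is the scaling with factor
  \<open>A \<boxtimes> B\<close>.\<close>

lemma times_assoc:
  assumes "A \<in> axis" "B \<in> axis" "C \<in> axis"
  shows "(A \<boxtimes> B) \<boxtimes> C = A \<boxtimes> (B \<boxtimes> C)"
proof -
  have "scaling (\<lambda>X. scal A (scal B X))"
    using scal assms dilatation_comp unfolding scaling_def by simp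
  from times_eq[OF this assms(3)] show ?thesis using scal assms unfolding times_def by simp
qed

lemma plus_times:
  assumes "A \<in> axis" "B \<in> axis" "C \<in> axis"
  shows "(A \<boxplus> B) \<boxtimes> C = A \<boxtimes> C \<boxplus> B \<boxtimes> C"
  using times_eq[OF scaling_sum[OF scal(1) scal(1)]] scal assms unfolding times_def by simp

lemma times_plus:
  assumes "A \<in> axis" "B \<in> axis" "C \<in> axis"
  shows "A \<boxtimes> (B \<boxplus> C) = A \<boxtimes> B \<boxplus> A \<boxtimes> C"
  using scaling_plus scal assms axis_point unfolding times_def by simp

text \<open>The scaling that takes \<open>A\<close> back to \<open>I\<close> has the inverse as its
  factor.\<close>

lemma ex_left_inverse:
  assumes "A \<in> axis" "A \<noteq> O\<^sub>0"
  shows "\<exists>B\<in>axis. B \<noteq> O\<^sub>0 \<and> B \<boxtimes> A = I"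
proof -
  have "par O\<^sub>0 A O\<^sub>0 I" using assms par_sym unfolding axis_def by blast
  then obtain \<sigma> where \<sigma>: "scaling \<sigma>" "\<sigma> A = I"
    using ex_central_dilatation assms unfolding scaling_def by metis
  then have "\<sigma> I \<in> axis" "\<sigma> I \<boxtimes> A = I" using scaling_in_axis I_in_axis times_eq assms by auto
  moreover from this have "\<sigma> I \<noteq> O\<^sub>0" using O_times assms O_ne_I by metis
  ultimately show ?thesis by blast
qed

lemma ex_inverse:
  assumes "A \<in> axis" "A \<noteq> O\<^sub>0"
  shows "\<exists>B\<in>axis. B \<boxtimes> A = I \<and> A \<boxtimes> B = I"
proof -
  obtain B where B: "B \<in> axis" "B \<noteq> O\<^sub>0" "B \<boxtimes> A = I" using ex_left_inverse assms by metis
  obtain D where D: "D \<in> axis" "D \<boxtimes> B = I" using ex_left_inverse B by metis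
  \<comment> \<open>Bracketing the product of \<open>D\<close>, \<open>B\<close>, \<open>A\<close>
    both ways gives \<open>A\<close> and \<open>D\<close>, so the left inverse \<open>B\<close> is
    two-sided.\<close>
  have "D = A" using times_assoc[OF D(1) B(1) assms(1)] D B I_times times_I assms by metis
  then show ?thesis using B D by metis
qed

section \<open>Agreement with the constructions by auxiliary points\<close>

lemma meet_par:
  assumes "\<not> par A B C D" "par A B P X" "par C D Q X"
  shows "meet_point (parallel_through \<L> P (line_through \<L> A B)) (parallel_through \<L> Q (line_through \<L> C D)) = X"
proof -
  have pts: "A \<in> \<P>" "B \<in> \<P>" "C \<in> \<P>" "D \<in> \<P>" using assms par_points by metis+
  have ne: "A \<noteq> B" "C \<noteq> D" using assms not_par_ne pts by metis+
  have on: "parallel_through \<L> P (line_through \<L> A B) \<in> \<L> \<and> X \<in> parallel_through \<L> P (line_through \<L> A B)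
     \<and> parallel_through \<L> P (line_through \<L> A B) \<parallel> line_through \<L> A B"
    if h: "par A B P X" "A \<noteq> B" for A B P X
  proof -
    obtain l m where "l \<in> \<L>" "m \<in> \<L>" "m \<parallel> l" "A \<in> l" "B \<in> l" "P \<in> m" "X \<in> m"
      using h(1) parallel_sym unfolding par_def by blast
    then show ?thesis using line_through_eq[of l A B] h(2) parallel_through_eq by metis
  qed
  have "\<not> line_through \<L> A B \<parallel> line_through \<L> C D" using assms par_line_through pts ne by metis
  then show ?thesis
    using meet_point_eq on[OF assms(2) ne(1)] on[OF assms(3) ne(2)]
      parallel_trans parallel_sym line_through pts ne by metis
qed

text \<open>Lets a line given directly count as a parallel through one of its points, so that
  \<open>meet_par\<close> covers every meet in the two constructions.\<close>

lemma parallel_through_self: "\<lbrakk>A \<in> \<P>; B \<in> \<P>; A \<noteq> B\<rbrakk> \<Longrightarrow> parallel_through \<L> A (line_through \<L> A B) = line_through \<L> A B"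
  using parallel_through_eq line_through parallel_refl by metis

lemma off_axis:
  assumes "B\<^sub>1 \<in> \<P>" "B\<^sub>1 \<notin> axis" "B \<in> axis"
  shows "\<not> par O\<^sub>0 I B B\<^sub>1"
  using assms line_ext O_ne_I unfolding axis_def by blast

text \<open>The construction follows \<open>transl A\<close>: the first meet is the image of
  \<open>B\<^sub>1\<close>, and the image of \<open>B\<close> is then found along a parallel to
  \<open>B B\<^sub>1\<close>. As this holds for every \<open>B\<^sub>1\<close> off the axis, the sum
  does not depend on it.\<close>

lemma add_via_eq:
  assumes "B\<^sub>1 \<in> \<P>" "B\<^sub>1 \<notin> axis" "A \<in> axis" "B \<in> axis"
  shows "add_via \<L> O\<^sub>0 I B\<^sub>1 A B = A \<boxplus> B"
proof -
  have pts: "A \<in> \<P>" "B \<in> \<P>" using assms axis_point by auto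
  have "meet_point (parallel_through \<L> B\<^sub>1 (line_through \<L> O\<^sub>0 I)) (parallel_through \<L> A (line_through \<L> O\<^sub>0 B\<^sub>1)) = A \<boxplus> B\<^sub>1"
  proof (rule meet_par)
    show "\<not> par O\<^sub>0 I O\<^sub>0 B\<^sub>1" using off_axis assms O_in_axis by metis
    show "par O\<^sub>0 B\<^sub>1 A (A \<boxplus> B\<^sub>1)" using par_plus pts assms by metis
    show "par O\<^sub>0 I B\<^sub>1 (A \<boxplus> B\<^sub>1)" using par_plus_on[of I A B\<^sub>1] assms plus_commute pts unfolding axis_def by simp
  qed
  moreover have "meet_point (parallel_through \<L> O\<^sub>0 (line_through \<L> O\<^sub>0 I))
     (parallel_through \<L> (A \<boxplus> B\<^sub>1) (line_through \<L> B B\<^sub>1)) = A \<boxplus> B"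
  proof (rule meet_par)
    show "\<not> par O\<^sub>0 I B B\<^sub>1" using off_axis assms by metis
    show "par O\<^sub>0 I O\<^sub>0 (A \<boxplus> B)" using plus_in_axis assms unfolding axis_def by blast
    have "par B\<^sub>1 B (A \<boxplus> B\<^sub>1) (A \<boxplus> B)" unfolding plus_def
      using dilatationD translation_dilatation transl pts assms by metis
    then show "par B B\<^sub>1 (A \<boxplus> B\<^sub>1) (A \<boxplus> B)" by (rule par_swap)
  qed
  ultimately show ?thesis unfolding add_via_def
    by (simp add: parallel_through_self O_ne_I)
qed

text \<open>The same argument with \<open>scal A\<close>, which takes \<open>I\<close> to
  \<open>A\<close> and \<open>B\<^sub>1\<close> to the first meet.\<close>

lemma mult_via_eq:
  assumes "B\<^sub>1 \<in> \<P>" "B\<^sub>1 \<notin> axis" "A \<in> axis" "B \<in> axis"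
  shows "mult_via \<L> O\<^sub>0 I B\<^sub>1 A B = A \<boxtimes> B"
proof -
  have pts: "A \<in> \<P>" "B \<in> \<P>" using assms axis_point by auto
  have ne: "O\<^sub>0 \<noteq> B\<^sub>1" using O_in_axis assms by auto
  have d: "dilatation (scal A)" "scal A I = A" using scal assms scaling_def by auto
  have n: "\<not> par O\<^sub>0 I O\<^sub>0 B\<^sub>1" using off_axis assms O_in_axis by metis
  have "meet_point (parallel_through \<L> A (line_through \<L> I B\<^sub>1)) (parallel_through \<L> O\<^sub>0 (line_through \<L> O\<^sub>0 B\<^sub>1)) = scal A B\<^sub>1"
  proof (rule meet_par)
    show "\<not> par I B\<^sub>1 O\<^sub>0 B\<^sub>1" using n col_perm par_flips by metis
    show "par I B\<^sub>1 A (scal A B\<^sub>1)" using dilatationD[OF d(1) I_point assms(1)] d(2) by metis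
    show "par O\<^sub>0 B\<^sub>1 O\<^sub>0 (scal A B\<^sub>1)" using scaling_par scal assms by metis
  qed
  moreover have "meet_point (parallel_through \<L> O\<^sub>0 (line_through \<L> O\<^sub>0 I))
     (parallel_through \<L> (scal A B\<^sub>1) (line_through \<L> B B\<^sub>1)) = A \<boxtimes> B"
  proof (rule meet_par)
    show "\<not> par O\<^sub>0 I B B\<^sub>1" using off_axis assms by metis
    show "par O\<^sub>0 I O\<^sub>0 (A \<boxtimes> B)" using times_in_axis assms unfolding axis_def by blast
    have "par B\<^sub>1 B (scal A B\<^sub>1) (A \<boxtimes> B)" unfolding times_def
      using dilatationD d pts assms by metis
    then show "par B B\<^sub>1 (scal A B\<^sub>1) (A \<boxtimes> B)" by (rule par_swap)
  qed
  ultimately show ?thesis unfolding mult_via_def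
    using assms ne by (simp add: parallel_through_self O_ne_I)
qed

lemma aux_point: "aux_point \<P> axis \<in> \<P>" "aux_point \<P> axis \<notin> axis"
proof -
  have "\<exists>X. X \<in> \<P> \<and> X \<notin> axis" using ex_off[OF O_point I_point O_ne_I] unfolding axis_def by blast
  from someI_ex[OF this] show "aux_point \<P> axis \<in> \<P>" "aux_point \<P> axis \<notin> axis"
    unfolding aux_point_def by auto
qed

lemma line_ring_simps:
  "carrier (line_ring \<P> \<L> O\<^sub>0 I) = axis" "\<one>\<^bsub>line_ring \<P> \<L> O\<^sub>0 I\<^esub> = I" "\<zero>\<^bsub>line_ring \<P> \<L> O\<^sub>0 I\<^esub> = O\<^sub>0"
  "\<lbrakk>A \<in> axis; B \<in> axis\<rbrakk> \<Longrightarrow> A \<oplus>\<^bsub>line_ring \<P> \<L> O\<^sub>0 I\<^esub> B = A \<boxplus> B"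
  "\<lbrakk>A \<in> axis; B \<in> axis\<rbrakk> \<Longrightarrow> A \<otimes>\<^bsub>line_ring \<P> \<L> O\<^sub>0 I\<^esub> B = A \<boxtimes> B"
  unfolding line_ring_def axis_eq_line[symmetric]
  using add_via_eq mult_via_eq aux_point by simp_all

lemma skew_field_line_ring: "skew_field (line_ring \<P> \<L> O\<^sub>0 I)"
proof -
  let ?R = "line_ring \<P> \<L> O\<^sub>0 I"
  have "abelian_group ?R"
    by (rule abelian_groupI)
      (simp_all add: line_ring_simps plus_in_axis plus_assoc axis_point O_in_axis ex_minus_axis,
       auto simp: line_ring_simps axis_point plus_commute dest: ex_minus_axis)
  moreover have "monoid ?R"
    by (rule monoidI) (simp_all add: line_ring_simps times_in_axis times_assoc I_in_axis I_times times_I)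
  ultimately have "ring ?R"
    by (intro ringI) (simp_all add: line_ring_simps plus_times times_plus plus_in_axis times_in_axis)
  moreover have "Units ?R = carrier ?R - {\<zero>\<^bsub>?R\<^esub>}"
  proof (intro equalityI subsetI)
    fix A assume "A \<in> Units ?R"
    then obtain B where "A \<in> axis" "B \<in> axis" "A \<boxtimes> B = I"
      unfolding Units_def by (auto simp: line_ring_simps)
    then show "A \<in> carrier ?R - {\<zero>\<^bsub>?R\<^esub>}" using O_times O_ne_I by (auto simp: line_ring_simps)
  next
    fix A assume "A \<in> carrier ?R - {\<zero>\<^bsub>?R\<^esub>}"
    then have A: "A \<in> axis" "A \<noteq> O\<^sub>0" by (simp_all add: line_ring_simps)
    then obtain B where "B \<in> axis" "B \<boxtimes> A = I" "A \<boxtimes> B = I" using ex_inverse by blast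
    then show "A \<in> Units ?R" unfolding Units_def using A(1) by (auto simp: line_ring_simps)
  qed
  ultimately show ?thesis
    using O_ne_I by (auto simp: skew_field_def skew_field_axioms_def line_ring_simps)
qed

end

section \<open>Ratios of three points\<close>

lemma (in skew_field) ratio_set_eq_carrier:
  assumes "B \<in> carrier R" "C \<in> carrier R" "B \<noteq> C"
  shows "ratio_set R B C = carrier R"
proof -
  have "B \<ominus> C \<in> carrier R - {\<zero>}" using assms r_right_minus_eq by auto
  then have u: "B \<ominus> C \<in> Units R" using skew_field_Units by simp
  show ?thesis
  proof
    show "ratio_set R B C \<subseteq> carrier R"
      unfolding ratio_set_def ratio3_def using assms u by auto
    show "carrier R \<subseteq> ratio_set R B C"
    proof
      fix Y assume Y: "Y \<in> carrier R"
      let ?X = "(B \<ominus> C) \<otimes> Y \<oplus> C"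
      have "?X \<ominus> C = (B \<ominus> C) \<otimes> Y"
        using assms Y by (simp add: minus_eq a_assoc r_neg)
      moreover have "inv (B \<ominus> C) \<otimes> ((B \<ominus> C) \<otimes> Y) = Y"
        using u Y m_assoc[of "inv (B \<ominus> C)" "B \<ominus> C" Y] Units_closed by simp
      ultimately have "ratio3 R B C ?X = Y"
        unfolding ratio3_def by simp
      moreover have "?X \<in> carrier R" using assms Y by simp
      ultimately show "Y \<in> ratio_set R B C"
        unfolding ratio_set_def by (metis (mono_tags, lifting) mem_Collect_eq)
    qed
  qed
qed

theorem theorem19:
  fixes \<P> :: "'p set" and \<L> :: "'p set set" and O\<^sub>0 I B C :: 'p
  assumes "desargues_affine_plane \<P> \<L>"
    and "O\<^sub>0 \<in> \<P>" and "I \<in> \<P>" and "O\<^sub>0 \<noteq> I"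
    and "B \<in> line_through \<L> O\<^sub>0 I" and "C \<in> line_through \<L> O\<^sub>0 I" and "B \<noteq> C"
  defines "K \<equiv> line_ring \<P> \<L> O\<^sub>0 I"
  shows "skew_field (K\<lparr>carrier := ratio_set K B C\<rparr>) \<and> sub_skew_field (ratio_set K B C) K"
proof -
  interpret desargues_frame \<P> \<L> O\<^sub>0 I
    using assms(1-4) by (simp add: desargues_frame_def desargues_frame_axioms_def)
  interpret F: skew_field K
    unfolding K_def by (rule skew_field_line_ring)
  have "ratio_set K B C = carrier K"
    using F.ratio_set_eq_carrier assms(5-7) unfolding K_def line_ring_def by simp
  moreover have "subring (carrier K) K" by (rule F.carrier_is_subring)
  \<comment> \<open>Every point of the line is a ratio, so the restriction to the ratio set is
    \<open>K\<close> itself.\<close>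
  ultimately show ?thesis
    using F.skew_field_axioms by (simp add: sub_skew_field_def sub_skew_field_axioms_def)
qed

end
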